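(* There is an algorithm, running in time $O(n^2+n|P|)$, that given a social network $(G,P,p,\theta)$ with $n$ nodes determines whether it admits a unique outcome. Furthermore, for social networks in which $\theta(i)>\frac12$ for all nodes $i$, there is an algorithm running in time $O(n^2)$ that determines whether the network admits a unique outcome.
   Context: Setting. $G=(V,E)$ is a finite weighted directed graph with no parallel edges and no self-loops, $n=|V|$, and each edge $(i,j)$ has a weight $w_{ij}\in[0,1]$. For a node $i$, $N(i)$ is the set of nodes $j$ with an edge $(j,i)\in E$ (the neighbours of $i$). It is assumed that $\sum_{j\in N(i)} w_{ji}\le 1$ for every node $i$ with $N(i)\ne\emptyset$. The threshold function $\theta$ assigns to each node $i$ a value $\theta(i)\in(0,1]$. $P$ is a finite set of products. A social network is a tuple $(G,P,p,\theta)$ where $p$ assigns to each node a non-empty subset of $P$; since $G,P,\theta$ are fixed, a social network is identified with $p$. Reductions. For a product $t$ and a node $i$, the adoption condition $A(t,i)$ holds in $p$ if $N(i)=\emptyset$, or if $N(i)\neq\emptyset$ and $\sum_{j\in N(i)\mid p(j)=\{t\}} w_{ji}\ge\theta(i)$. Write $p_1\to p_2$ if $p_2\ne p_1$ and for all nodes $i$ with $p_2(i)\ne p_1(i)$ we have $|p_1(i)|\ge 2$ and, for some $t\in p_1(i)$, $p_2(i)=\{t\}$ and $A(t,i)$ holds in $p_1$. Let $\to^*$ be the reflexive, transitive closure of $\to$. A reduction sequence $p\to^* p'$ is maximal if there is no $p''$ with $p'\to p''$. A network $p'$ is unavoidable from $p$ if for all maximal reduction sequences $p\to^* p''$ we have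 $p'=p''$. The network $p$ has (admits) a unique outcome if some social network is unavoidable from $p$. *)

theory Defs
  imports Complex_Main "HOL-Library.FuncSet" "HOL-Library.Landau_Symbols"
begin

section \<open>Social networks\<close>

text \<open>
  Everything that stays fixed during diffusion. The value of \<open>weight\<close> outside the edge set is
  never used; an edge may have weight \<open>0\<close>, so \<open>edges\<close> cannot be recovered from \<open>weight\<close>.
\<close>

record ('v, 'p) setting =
  nodes :: "'v set"
  edges :: "('v \<times> 'v) set"
  weight :: "'v \<Rightarrow> 'v \<Rightarrow> real"
  products :: "'p set"
  threshold :: "'v \<Rightarrow> real"

definition neighbours :: "('v, 'p) setting \<Rightarrow> 'v \<Rightarrow> 'v set" where
  "neighbours S i = {j. (j, i) \<in> edges S}"

definition valid_setting :: "('v, 'p) setting \<Rightarrow> bool" where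
  "valid_setting S \<longleftrightarrow>
     finite (nodes S) \<and> edges S \<subseteq> nodes S \<times> nodes S \<and> irrefl (edges S) \<and>
     (\<forall>(i, j) \<in> edges S. 0 \<le> weight S i j \<and> weight S i j \<le> 1) \<and>
     (\<forall>i \<in> nodes S. neighbours S i \<noteq> {} \<longrightarrow> (\<Sum>j \<in> neighbours S i. weight S j i) \<le> 1) \<and>
     finite (products S) \<and>
     (\<forall>i \<in> nodes S. 0 < threshold S i \<and> threshold S i \<le> 1)"

text \<open>
  Extensional functions on the nodes, so that \<open>=\<close> on the function type is equality of
  social networks.
\<close>

definition social_networks :: "('v, 'p) setting \<Rightarrow> ('v \<Rightarrow> 'p set) set" where
  "social_networks S = nodes S \<rightarrow>\<^sub>E (Pow (products S) - {{}})"

definition adoptable :: "('v, 'p) setting \<Rightarrow> ('v \<Rightarrow> 'p set) \<Rightarrow> 'p \<Rightarrow> 'v \<Rightarrow> bool" where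
  "adoptable S p t i \<longleftrightarrow>
     neighbours S i = {} \<or>
     neighbours S i \<noteq> {} \<and>
       (\<Sum>j \<in> {j \<in> neighbours S i. p j = {t}}. weight S j i) \<ge> threshold S i"

definition reduces :: "('v, 'p) setting \<Rightarrow> ('v \<Rightarrow> 'p set) \<Rightarrow> ('v \<Rightarrow> 'p set) \<Rightarrow> bool" where
  "reduces S p1 p2 \<longleftrightarrow>
     p1 \<in> social_networks S \<and> p2 \<in> social_networks S \<and> p2 \<noteq> p1 \<and>
     (\<forall>i \<in> nodes S. p2 i \<noteq> p1 i \<longrightarrow>
        card (p1 i) \<ge> 2 \<and> (\<exists>t \<in> p1 i. p2 i = {t} \<and> adoptable S p1 t i))"

definition maximal_reduction ::
    "('v, 'p) setting \<Rightarrow> ('v \<Rightarrow> 'p set) \<Rightarrow> ('v \<Rightarrow> 'p set) \<Rightarrow> bool" where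
  "maximal_reduction S p p' \<longleftrightarrow> (reduces S)\<^sup>*\<^sup>* p p' \<and> (\<nexists>p''. reduces S p' p'')"

definition unavoidable :: "('v, 'p) setting \<Rightarrow> ('v \<Rightarrow> 'p set) \<Rightarrow> ('v \<Rightarrow> 'p set) \<Rightarrow> bool" where
  "unavoidable S p p' \<longleftrightarrow> (\<forall>p''. maximal_reduction S p p'' \<longrightarrow> p' = p'')"

definition unique_outcome :: "('v, 'p) setting \<Rightarrow> ('v \<Rightarrow> 'p set) \<Rightarrow> bool" where
  "unique_outcome S p \<longleftrightarrow> (\<exists>p' \<in> social_networks S. unavoidable S p p')"


section \<open>Algorithms: while programs on a random access machine\<close>

text \<open>
  A uniform-cost RAM whose memory consists of named, unbounded, one-dimensional arrays: one family
  holds natural numbers, the other real numbers (weights and thresholds are real); a scalar is the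
  entry at index \<open>0\<close>. The only arithmetic is addition and subtraction (truncated on the naturals).
  There is deliberately no multiplication, no rounding, no passage between the two sorts other
  than through control flow, and there are no non-integer constants, since these could make
  unit-cost steps unreasonably powerful.
\<close>

record mem =
  nmem :: "string \<Rightarrow> nat \<Rightarrow> nat"
  rmem :: "string \<Rightarrow> nat \<Rightarrow> real"

datatype nexp = NNum nat | NGet string nexp | NAdd nexp nexp | NSub nexp nexp

datatype rexp = RNum int | RGet string nexp | RAdd rexp rexp | RSub rexp rexp

datatype bexp = NLess nexp nexp | RLess rexp rexp | BNot bexp | BAnd bexp bexp

datatype com =
    Skip
  | NSet string nexp nexp
  | RSet string nexp rexp
  | Seq com com
  | Cond bexp com com
  | While bexp com

fun nval :: "nexp \<Rightarrow> mem \<Rightarrow> nat" where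
  "nval (NNum k) s = k"
| "nval (NGet a e) s = nmem s a (nval e s)"
| "nval (NAdd e1 e2) s = nval e1 s + nval e2 s"
| "nval (NSub e1 e2) s = nval e1 s - nval e2 s"

fun rval :: "rexp \<Rightarrow> mem \<Rightarrow> real" where
  "rval (RNum k) s = of_int k"
| "rval (RGet a e) s = rmem s a (nval e s)"
| "rval (RAdd e1 e2) s = rval e1 s + rval e2 s"
| "rval (RSub e1 e2) s = rval e1 s - rval e2 s"

fun bval :: "bexp \<Rightarrow> mem \<Rightarrow> bool" where
  "bval (NLess e1 e2) s \<longleftrightarrow> nval e1 s < nval e2 s"
| "bval (RLess e1 e2) s \<longleftrightarrow> rval e1 s < rval e2 s"
| "bval (BNot b) s \<longleftrightarrow> \<not> bval b s"
| "bval (BAnd b1 b2) s \<longleftrightarrow> bval b1 s \<and> bval b2 s"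

definition nset :: "string \<Rightarrow> nat \<Rightarrow> nat \<Rightarrow> mem \<Rightarrow> mem" where
  "nset a k v s = s\<lparr>nmem := (nmem s)(a := (nmem s a)(k := v))\<rparr>"

definition rset :: "string \<Rightarrow> nat \<Rightarrow> real \<Rightarrow> mem \<Rightarrow> mem" where
  "rset a k v s = s\<lparr>rmem := (rmem s)(a := (rmem s a)(k := v))\<rparr>"

text \<open>
  \<open>exec c s t s'\<close>: started in \<open>s\<close>, the program \<open>c\<close> halts in \<open>s'\<close> after exactly \<open>t\<close> steps.
  Each assignment and each test is one step. The size of the expressions in a program does not
  depend on the input, so charging for every single operation instead would change running times
  only by a constant factor.
\<close>

inductive exec :: "com \<Rightarrow> mem \<Rightarrow> nat \<Rightarrow> mem \<Rightarrow> bool" where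
  Skip: "exec Skip s 1 s"
| NSet: "exec (NSet a k e) s 1 (nset a (nval k s) (nval e s) s)"
| RSet: "exec (RSet a k e) s 1 (rset a (nval k s) (rval e s) s)"
| Seq: "exec c1 s t1 s1 \<Longrightarrow> exec c2 s1 t2 s2 \<Longrightarrow> exec (Seq c1 c2) s (t1 + t2) s2"
| CondTrue: "bval b s \<Longrightarrow> exec c1 s t s1 \<Longrightarrow> exec (Cond b c1 c2) s (1 + t) s1"
| CondFalse: "\<not> bval b s \<Longrightarrow> exec c2 s t s1 \<Longrightarrow> exec (Cond b c1 c2) s (1 + t) s1"
| WhileFalse: "\<not> bval b s \<Longrightarrow> exec (While b c) s 1 s"
| WhileTrue: "bval b s \<Longrightarrow> exec c s t1 s1 \<Longrightarrow> exec (While b c) s1 t2 s2 \<Longrightarrow>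
    exec (While b c) s (1 + t1 + t2) s2"

inductive_cases exec_SkipE: "exec Skip s t s'"
inductive_cases exec_NSetE: "exec (NSet a k e) s t s'"
inductive_cases exec_RSetE: "exec (RSet a k e) s t s'"
inductive_cases exec_SeqE: "exec (Seq c1 c2) s t s'"
inductive_cases exec_CondE: "exec (Cond b c1 c2) s t s'"
inductive_cases exec_WhileE: "exec (While b c) s t s'"

lemma exec_deterministic:
  "exec c s t s' \<Longrightarrow> exec c s u s'' \<Longrightarrow> u = t \<and> s'' = s'"
proof (induction arbitrary: u s'' rule: exec.induct)
  case (Seq c1 s t1 s1 c2 t2 s2)
  from Seq.prems show ?case
    by (rule exec_SeqE) (metis Seq.IH)
next
  case (CondTrue b s c1 t s1 c2)
  from CondTrue.prems show ?case
    by (rule exec_CondE) (use CondTrue.hyps in \<open>auto dest: CondTrue.IH\<close>)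
next
  case (CondFalse b s c2 t s1 c1)
  from CondFalse.prems show ?case
    by (rule exec_CondE) (use CondFalse.hyps in \<open>auto dest: CondFalse.IH\<close>)
next
  case (WhileFalse b s c)
  from WhileFalse.prems show ?case
    by (rule exec_WhileE) (use WhileFalse.hyps in simp_all)
next
  case (WhileTrue b s c t1 s1 t2 s2)
  from WhileTrue.prems show ?case
    by (rule exec_WhileE) (use WhileTrue.hyps in \<open>auto dest!: WhileTrue.IH\<close>)
qed (erule exec_SkipE exec_NSetE exec_RSetE, simp)+


section \<open>Social networks as inputs, and deciding unique outcomes\<close>

text \<open>
  Nodes are numbered \<open>0, \<dots>, n - 1\<close> and products \<open>0, \<dots>, m - 1\<close>. The graph is given by its adjacency
  matrix and its weight matrix (row by row), and \<open>p i\<close> by its size and the list \<open>ps i\<close> of its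
  elements, which starts at position \<open>i * m\<close> of the array \<open>prod\<close>. All other memory cells are \<open>0\<close>.
  With a bit vector of length \<open>m\<close> in place of the list, already deciding whether \<open>p i\<close> is a
  singleton would take time proportional to \<open>m\<close> in the worst case, so that no time bound
  independent of \<open>m\<close> could hold.
\<close>

definition encode :: "nat \<Rightarrow> nat \<Rightarrow> (nat, nat) setting \<Rightarrow> (nat \<Rightarrow> nat list) \<Rightarrow> mem" where
  "encode n m S ps = \<lparr>
     nmem = (\<lambda>a k. 0)(
       ''n'' := (\<lambda>k. if k = 0 then n else 0),
       ''m'' := (\<lambda>k. if k = 0 then m else 0),
       ''edge'' := (\<lambda>k. if k < n * n \<and> (k div n, k mod n) \<in> edges S then 1 else 0),
       ''size'' := (\<lambda>k. if k < n then length (ps k) else 0),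
       ''prod'' := (\<lambda>k. if k < n * m \<and> k mod m < length (ps (k div m))
                          then ps (k div m) ! (k mod m) else 0)),
     rmem = (\<lambda>a k. 0)(
       ''weight'' := (\<lambda>k. if k < n * n \<and> (k div n, k mod n) \<in> edges S
                          then weight S (k div n) (k mod n) else 0),
       ''threshold'' := (\<lambda>k. if k < n then threshold S k else 0)) \<rparr>"

text \<open>
  The program \<open>c\<close> decides, within \<open>T n m\<close> steps on inputs with \<open>n\<close> nodes and \<open>m\<close> products, whether a
  social network whose setting satisfies \<open>Q\<close> has a unique outcome. It has to cope with every order
  of listing the sets \<open>p i\<close>.
\<close>

definition decides_unique_outcome ::
    "com \<Rightarrow> ((nat, nat) setting \<Rightarrow> bool) \<Rightarrow> (nat \<Rightarrow> nat \<Rightarrow> nat) \<Rightarrow> bool" where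
  "decides_unique_outcome c Q T \<longleftrightarrow>
     (\<forall>n m S p ps.
        valid_setting S \<and> nodes S = {..<n} \<and> products S = {..<m} \<and> Q S \<and>
        p \<in> social_networks S \<and> (\<forall>i<n. distinct (ps i) \<and> set (ps i) = p i) \<longrightarrow>
        (\<exists>t s. t \<le> T n m \<and> exec c (encode n m S ps) t s \<and>
               nmem s ''result'' 0 = (if unique_outcome S p then 1 else 0)))"

end

theory Submission
  imports Defs
begin

text \<open>
  Let \<open>r\<close> be a network reached from \<open>p\<close> by adopting greedily. The outcome is unique iff no node with
  several products in \<open>p\<close> can, in \<open>r\<close>, adopt one of them different from its choice in \<open>r\<close>: adoption
  conditions are monotone, so every reduction stays below \<open>r\<close> if there is no such node; and if \<open>i\<close>
  could adopt \<open>t\<close>, then performing only the \<open>t\<close>-adoptions of \<open>r\<close> leads to an outcome where \<open>i\<close>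
  has chosen \<open>t\<close>. A queue of adopting nodes, each announcing its choice once along its outgoing row
  of the matrices, computes \<open>r\<close> and the sums for all pairs of a node and a product in time
  \<open>O(n\<^sup>2)\<close>; reading the product lists costs \<open>O(nm)\<close>. If all thresholds exceed \<open>1/2\<close>, two products
  can compete only at a node without neighbours, so only such nodes have to be looked for.
\<close>

section \<open>Outcomes of a diffusion\<close>

lemma finite_neighbours: "valid_setting S \<Longrightarrow> finite (neighbours S i)"
  by (rule finite_subset[of _ "nodes S"]) (auto simp: valid_setting_def neighbours_def)

lemma neighbours_subset: "valid_setting S \<Longrightarrow> neighbours S i \<subseteq> nodes S"
  by (auto simp: valid_setting_def neighbours_def)

lemma weight_nonneg: "valid_setting S \<Longrightarrow> j \<in> neighbours S i \<Longrightarrow> 0 \<le> weight S j i"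
  by (auto simp: valid_setting_def neighbours_def)

text \<open>Weights are nonnegative, so additional neighbours committed to \<open>t\<close> can only
  increase the sum.\<close>

lemma adoptable_mono:
  assumes "valid_setting S" "adoptable S p t i"
    and le: "\<And>j. j \<in> nodes S \<Longrightarrow> p j = {t} \<Longrightarrow> q j = {t}"
  shows "adoptable S q t i"
proof (cases "neighbours S i = {}")
  case False
  have "(\<Sum>j \<in> {j \<in> neighbours S i. p j = {t}}. weight S j i)
      \<le> (\<Sum>j \<in> {j \<in> neighbours S i. q j = {t}}. weight S j i)"
  proof (rule sum_mono2)
    show "{j \<in> neighbours S i. p j = {t}} \<subseteq> {j \<in> neighbours S i. q j = {t}}"
      using neighbours_subset[OF assms(1)] le by blast
  qed (use finite_neighbours[OF assms(1)] weight_nonneg[OF assms(1)] in auto)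
  with assms(2) False show ?thesis by (auto simp: adoptable_def)
qed (simp add: adoptable_def)

lemma reaches_social_networks:
  "(reduces S)\<^sup>*\<^sup>* p q \<Longrightarrow> p \<in> social_networks S \<Longrightarrow> q \<in> social_networks S"
  by (induction rule: rtranclp_induct) (auto simp: reduces_def)

lemma social_networks_outside:
  "p \<in> social_networks S \<Longrightarrow> i \<notin> nodes S \<Longrightarrow> p i = undefined"
  by (auto simp: social_networks_def PiE_def extensional_def)

lemma reduces_cases:
  assumes "reduces S p q"
  obtains "q i = p i"
  | t where "i \<in> nodes S" "2 \<le> card (p i)" "t \<in> p i" "q i = {t}" "adoptable S p t i"
proof (cases "q i = p i")
  case False
  then have "i \<in> nodes S"
    using assms social_networks_outside[of p S i] social_networks_outside[of q S i]
    by (auto simp: reduces_def)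
  with False assms that(2) show ?thesis by (auto simp: reduces_def)
qed (use that(1) in blast)

text \<open>An adoption leaves a singleton, and only sets of size at least 2 are ever reduced. Hence
  a node changes at most once along a whole sequence.\<close>

lemma reaches_cases:
  assumes "(reduces S)\<^sup>*\<^sup>* p q"
  obtains "q i = p i" | t where "i \<in> nodes S" "2 \<le> card (p i)" "t \<in> p i" "q i = {t}"
proof -
  have "q i = p i \<or> i \<in> nodes S \<and> 2 \<le> card (p i) \<and> (\<exists>t \<in> p i. q i = {t})"
    using assms
  proof (induction rule: rtranclp_induct)
    case (step q r)
    from step.hyps(2) show ?case
      by (cases rule: reduces_cases[of _ _ _ i]) (use step.IH in auto)
  qed simp
  with that show thesis by blast
qed

lemma reaches_singleton: "(reduces S)\<^sup>*\<^sup>* p q \<Longrightarrow> p i = {t} \<Longrightarrow> q i = {t}"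
  by (erule reaches_cases[where i = i]) auto

lemma reaches_unchanged: "(reduces S)\<^sup>*\<^sup>* p q \<Longrightarrow> 2 \<le> card (q i) \<Longrightarrow> q i = p i"
  by (erule reaches_cases[where i = i]) simp_all

lemma reduces_upd:
  assumes "p \<in> social_networks S" "i \<in> nodes S" "2 \<le> card (p i)" "t \<in> p i" "adoptable S p t i"
  shows "reduces S p (p(i := {t}))"
proof -
  have "p i \<noteq> {t}" using assms(3) by auto
  then have "p(i := {t}) \<noteq> p" by (metis fun_upd_same)
  moreover have "p(i := {t}) \<in> social_networks S"
    using assms by (auto simp: social_networks_def PiE_def extensional_def Pi_def)
  ultimately show ?thesis using assms by (auto simp: reduces_def)
qed

text \<open>Every reduction turns some undecided node into a decided one and never the reverse, so
  the number of nodes with at least two products strictly decreases.\<close>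

lemma ex_maximal_reduction:
  assumes "valid_setting S"
  shows "\<exists>q. maximal_reduction S p q"
proof (induction "card {i \<in> nodes S. 2 \<le> card (p i)}" arbitrary: p rule: less_induct)
  case less
  show ?case
  proof (cases "\<exists>q. reduces S p q")
    case True
    then obtain q where q: "reduces S p q" ..
    have "{i \<in> nodes S. 2 \<le> card (q i)} \<subset> {i \<in> nodes S. 2 \<le> card (p i)}"
    proof
      show "{i \<in> nodes S. 2 \<le> card (q i)} \<subseteq> {i \<in> nodes S. 2 \<le> card (p i)}"
      proof
        fix i assume "i \<in> {i \<in> nodes S. 2 \<le> card (q i)}"
        with q show "i \<in> {i \<in> nodes S. 2 \<le> card (p i)}"
          by (cases rule: reduces_cases[of S p q i]) auto
      qed
      from q obtain i where "q i \<noteq> p i" unfolding reduces_def by blast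
      with q have "i \<in> nodes S" "2 \<le> card (p i)" "\<not> 2 \<le> card (q i)"
        by (cases rule: reduces_cases[of S p q i]; simp)+
      then show "{i \<in> nodes S. 2 \<le> card (q i)} \<noteq> {i \<in> nodes S. 2 \<le> card (p i)}"
        by blast
    qed
    with assms have "card {i \<in> nodes S. 2 \<le> card (q i)} < card {i \<in> nodes S. 2 \<le> card (p i)}"
      by (intro psubset_card_mono) (auto simp: valid_setting_def)
    from less[OF this] obtain r where "maximal_reduction S q r" ..
    with q have "maximal_reduction S p r"
      by (auto simp: maximal_reduction_def intro: converse_rtranclp_into_rtranclp)
    then show ?thesis by blast
  qed (auto simp: maximal_reduction_def)
qed

text \<open>Both \<open>q\<close> and \<open>r\<close> extend to maximal networks, where their
  choices at \<open>i\<close> survive. An unavoidable network would equal both extensions.\<close>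

lemma not_unique_outcome:
  assumes "valid_setting S" and reach: "(reduces S)\<^sup>*\<^sup>* p q" "(reduces S)\<^sup>*\<^sup>* p r"
    and "q i = {t}" "r i = {u}" "t \<noteq> u"
  shows "\<not> unique_outcome S p"
proof
  assume "unique_outcome S p"
  then obtain o' where o': "\<And>x. maximal_reduction S p x \<Longrightarrow> o' = x"
    by (auto simp: unique_outcome_def unavoidable_def)
  have *: "o' i = {v}" if "(reduces S)\<^sup>*\<^sup>* p x" "x i = {v}" for x v
  proof -
    obtain y where "maximal_reduction S x y" using ex_maximal_reduction[OF assms(1)] ..
    then have y: "(reduces S)\<^sup>*\<^sup>* x y" "\<nexists>z. reduces S y z" by (simp_all add: maximal_reduction_def)
    from that(1) y(1) have "(reduces S)\<^sup>*\<^sup>* p y" by simp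
    with y(2) have "maximal_reduction S p y" by (simp add: maximal_reduction_def)
    with y(1) o' have "(reduces S)\<^sup>*\<^sup>* x o'" by simp
    with that(2) show ?thesis by (rule reaches_singleton[rotated])
  qed
  from *[OF reach(1)] *[OF reach(2)] assms(4-6) show False by auto
qed

text \<open>
  Whether a node can adopt \<open>t\<close> depends only on the nodes that have already adopted \<open>t\<close>, so the
  adoptions of all other products can be dropped from a reduction sequence.
\<close>

lemma reaches_single_product:
  fixes p :: "'a \<Rightarrow> 'b set"
  assumes valid: "valid_setting S" and p: "p \<in> social_networks S" and "(reduces S)\<^sup>*\<^sup>* p r"
  shows "(reduces S)\<^sup>*\<^sup>* p (\<lambda>j. if r j = {t} then {t} else p j)"
proof -
  define f where "f x = (\<lambda>j. if x j = {t} then {t} else p j)" for x :: "'a \<Rightarrow> 'b set"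
  show ?thesis using assms(3) unfolding f_def[symmetric]
  proof (induction rule: rtranclp_induct)
    case base
    have "f p = p" by (auto simp: f_def)
    then show ?case by simp
  next
    case (step r r')
    have keep: "r' i = {t}" if "r i = {t}" for i
      using step.hyps(2) that reaches_singleton[of S r r' i t] by blast
    have fn: "f x \<in> social_networks S" if "x \<in> social_networks S" for x
      using p that by (auto simp: f_def social_networks_def PiE_def extensional_def Pi_def)
    \<comment> \<open>A step that adopts only products other than \<open>t\<close> is invisible to
      \<open>f\<close>, so no reduction need correspond to it.\<close>
    have "f r' = f r \<or> reduces S (f r) (f r')"
    proof (cases "f r' = f r")
      case False
      have "2 \<le> card (f r i) \<and> (\<exists>u \<in> f r i. f r' i = {u} \<and> adoptable S (f r) u i)"
        if i: "f r' i \<noteq> f r i" for i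
      proof -
        from i keep have ri: "r' i = {t}" "r i \<noteq> {t}" by (auto simp: f_def split: if_splits)
        from step.hyps(2) ri have *: "2 \<le> card (r i)" "t \<in> r i" "adoptable S r t i"
          by (cases rule: reduces_cases[of S r r' i]; simp)+
        \<comment> \<open>The adopting node still has several products in \<open>r\<close>, so it
          has never changed and \<open>f r i\<close> is \<open>p i\<close> as well.\<close>
        from step.hyps(1) *(1) have "r i = p i"
          by (rule reaches_unchanged)
        moreover have "adoptable S (f r) t i"
          by (rule adoptable_mono[OF valid *(3)]) (simp add: f_def)
        ultimately show ?thesis using * ri by (auto simp: f_def)
      qed
      with False fn step.hyps(2) show ?thesis by (simp add: reduces_def)
    qed auto
    with step.IH show ?case by (auto intro: rtranclp.rtrancl_into_rtrancl)
  qed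
qed

text \<open>Even if \<open>i\<close> has chosen another product in \<open>r\<close>, it is still
  undecided once only the adoptions of \<open>t\<close> are performed, while all supporters of
  \<open>t\<close> in \<open>r\<close> are kept.\<close>

lemma adoptable_reached:
  assumes valid: "valid_setting S" and p: "p \<in> social_networks S" and reach: "(reduces S)\<^sup>*\<^sup>* p r"
    and i: "i \<in> nodes S" "2 \<le> card (p i)" "t \<in> p i" "adoptable S r t i"
  shows "\<exists>r'. (reduces S)\<^sup>*\<^sup>* p r' \<and> r' i = {t}"
proof (cases "r i = {t}")
  case False
  let ?r = "\<lambda>j. if r j = {t} then {t} else p j"
  have r: "(reduces S)\<^sup>*\<^sup>* p ?r"
    by (rule reaches_single_product[OF valid p reach])
  have "adoptable S ?r t i" by (rule adoptable_mono[OF valid i(4)]) simp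
  then have "reduces S ?r (?r(i := {t}))"
    using False i reaches_social_networks[OF r p] by (intro reduces_upd) auto
  with r have "(reduces S)\<^sup>*\<^sup>* p (?r(i := {t}))" by simp
  then show ?thesis by (intro exI[of _ "?r(i := {t})"]) simp
qed (use reach in blast)

section \<open>Criteria for a unique outcome\<close>

text \<open>Every choice made in a reduction from \<open>p\<close> is also made in \<open>r\<close>,
  by \<open>stable\<close>, and in each maximal \<open>q\<close>, by maximality. Applied to
  \<open>q\<close> and to \<open>r\<close> respectively, this yields the same decided nodes with the
  same choices.\<close>

lemma unique_outcomeI:
  assumes valid: "valid_setting S" and p: "p \<in> social_networks S" and r: "(reduces S)\<^sup>*\<^sup>* p r"
    and stable: "\<And>i t. i \<in> nodes S \<Longrightarrow> 2 \<le> card (p i) \<Longrightarrow> t \<in> p i \<Longrightarrow> adoptable S r t i \<Longrightarrow> r i = {t}"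
  shows "unique_outcome S p"
proof -
  have "r = q" if q: "(reduces S)\<^sup>*\<^sup>* p q" and max: "\<nexists>q'. reduces S q q'" for q
  proof -
    have le: "r i = {t}" if "(reduces S)\<^sup>*\<^sup>* p x" "x i = {t}" for x i t
      using that
    proof (induction arbitrary: i t rule: rtranclp_induct)
      case (step x y)
      from step.hyps(2) show ?case
      proof (cases rule: reduces_cases[of _ _ _ i])
        case (2 u)
        with step.prems have u: "u = t" by simp
        from step.hyps(1) 2(2) have "x i = p i" by (rule reaches_unchanged)
        with 2 u show ?thesis
          using stable adoptable_mono[OF valid, of x t i r] step.IH by auto
      qed (use step.IH[of i t] step.prems in metis)
    qed (use r in \<open>auto dest: reaches_singleton\<close>)
    \<comment> \<open>In the inductive step the adoption condition carries over to \<open>q\<close>.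
      If \<open>i\<close> were undecided in \<open>q\<close>, then \<open>q\<close> would not be
      maximal; if it had chosen another product, \<open>le\<close> would force a second choice at
      \<open>i\<close> on \<open>r\<close>.\<close>
    have ge: "q i = {t}" if "(reduces S)\<^sup>*\<^sup>* p x" "x i = {t}" for x i t
      using that
    proof (induction arbitrary: i t rule: rtranclp_induct)
      case (step x y)
      from step.hyps(2) show ?case
      proof (cases rule: reduces_cases[of _ _ _ i])
        case (2 u)
        with step.prems have u: "u = t" by simp
        from step.hyps(1) 2(2) have x: "x i = p i" by (rule reaches_unchanged)
        have aq: "adoptable S q t i"
          using 2 u adoptable_mono[OF valid, of x t i q] step.IH by auto
        then have ri: "r i = {t}"
          using 2 u x stable adoptable_mono[OF valid aq, of r] le[OF q] by auto
        from q show ?thesis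
        proof (cases rule: reaches_cases[of _ _ _ i])
          case 1
          have "reduces S q (q(i := {t}))"
            using 1 2 u x aq reaches_social_networks[OF q p] by (intro reduces_upd) auto
          with max show ?thesis by blast
        next
          case (2 v)
          with le[OF q this(4)] ri show ?thesis by simp
        qed
      qed (use step.IH[of i t] step.prems in metis)
    qed (use q in \<open>auto dest: reaches_singleton\<close>)
    show "r = q"
    proof
      fix i
      from r show "r i = q i"
      proof (cases rule: reaches_cases[of _ _ _ i])
        case 1
        from q show ?thesis
        proof (cases rule: reaches_cases[of _ _ _ i])
          case (2 t)
          then show ?thesis using le[OF q 2(4)] by simp
        qed (simp add: 1)
      next
        case (2 t)
        then show ?thesis using ge[OF r 2(4)] by simp
      qed
    qed
  qed
  then show ?thesis
    using reaches_social_networks[OF r p]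
    by (auto simp: unique_outcome_def unavoidable_def maximal_reduction_def)
qed

text \<open>Without neighbours every adoption condition holds from the start, so \<open>i\<close>
  can be made to choose either of two products.\<close>

lemma not_unique_outcome_source:
  assumes valid: "valid_setting S" and p: "p \<in> social_networks S"
    and i: "i \<in> nodes S" "2 \<le> card (p i)" "neighbours S i = {}"
  shows "\<not> unique_outcome S p"
proof -
  have reached: "\<exists>r. (reduces S)\<^sup>*\<^sup>* p r \<and> r i = {t}" if "t \<in> p i" for t
    using adoptable_reached[OF valid p rtranclp.rtrancl_refl i(1,2) that] i(3)
    by (simp add: adoptable_def)
  from i(2) obtain t u where tu: "t \<in> p i" "u \<in> p i" "t \<noteq> u"
    by (auto simp: numeral_2_eq_2 card_le_Suc_iff)
  from reached[OF tu(1)] reached[OF tu(2)] obtain q r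
    where "(reduces S)\<^sup>*\<^sup>* p q" "(reduces S)\<^sup>*\<^sup>* p r" "q i = {t}" "r i = {u}" by blast
  then show ?thesis using tu(3) by (rule not_unique_outcome[OF valid])
qed

text \<open>Two products adoptable at the same node would have disjoint sets of supporters, each of
  weight above 1/2, while the incoming weights sum to at most 1. Hence any maximal \<open>r\<close>
  meets the criterion of \<open>unique_outcomeI\<close>.\<close>

lemma unique_outcome_large_thresholds:
  assumes valid: "valid_setting S" and p: "p \<in> social_networks S"
    and large: "\<And>i. i \<in> nodes S \<Longrightarrow> threshold S i > 1 / 2"
    and nosource: "\<And>i. i \<in> nodes S \<Longrightarrow> 2 \<le> card (p i) \<Longrightarrow> neighbours S i \<noteq> {}"
  shows "unique_outcome S p"
proof -
  obtain r where r: "(reduces S)\<^sup>*\<^sup>* p r" and max: "\<nexists>q. reduces S r q"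
    using ex_maximal_reduction[OF valid] by (auto simp: maximal_reduction_def)
  have once: "t = u" if i: "i \<in> nodes S" "2 \<le> card (p i)"
    and ad: "adoptable S r t i" "adoptable S r u i" for i t u
  proof (rule ccontr)
    assume "t \<noteq> u"
    let ?N = "\<lambda>t. {j \<in> neighbours S i. r j = {t}}"
    have "threshold S i + threshold S i
        \<le> (\<Sum>j \<in> ?N t. weight S j i) + (\<Sum>j \<in> ?N u. weight S j i)"
      using ad nosource[OF i] by (auto simp: adoptable_def)
    also have "\<dots> = (\<Sum>j \<in> ?N t \<union> ?N u. weight S j i)"
      using \<open>t \<noteq> u\<close> finite_neighbours[OF valid]
      by (intro sum.union_disjoint[symmetric]) auto
    also have "\<dots> \<le> (\<Sum>j \<in> neighbours S i. weight S j i)"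
      using finite_neighbours[OF valid] weight_nonneg[OF valid] by (intro sum_mono2) auto
    also have "\<dots> \<le> 1" using valid i nosource[OF i] by (auto simp: valid_setting_def)
    finally show False using large[OF i(1)] by simp
  qed
  show ?thesis
  proof (rule unique_outcomeI[OF valid p r])
    fix i t assume i: "i \<in> nodes S" "2 \<le> card (p i)" "t \<in> p i" "adoptable S r t i"
    \<comment> \<open>As \<open>p i\<close> is no singleton, a singleton at \<open>i\<close> comes
      from an adoption, and its condition persists because supporters never change their
      choice.\<close>
    from r have reached: "\<And>u. r i = {u} \<Longrightarrow> adoptable S r u i"
    proof (induction rule: rtranclp_induct)
      case base
      with i(2) show ?case by auto
    next
      case (step x y)
      from step.hyps(2) show ?case
      proof (cases rule: reduces_cases[of _ _ _ i])
        case 1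
        show ?thesis
          using step 1 adoptable_mono[OF valid, of x u i y]
            reaches_singleton[OF r_into_rtranclp[of "reduces S", OF step.hyps(2)]]
          by auto
      next
        case (2 v)
        then show ?thesis
          using step adoptable_mono[OF valid, of x u i y]
            reaches_singleton[OF r_into_rtranclp[of "reduces S", OF step.hyps(2)]]
          by auto
      qed
    qed
    from r show "r i = {t}"
    proof (cases rule: reaches_cases[of _ _ _ i])
      case 1
      with i max reduces_upd[of r S i t] reaches_social_networks[OF r p] show ?thesis by auto
    next
      case (2 u)
      with once[OF i(1,2) i(4) reached] show ?thesis by simp
    qed
  qed
qed

section \<open>Running times of programs\<close>

notation Seq (infixr \<open>;;\<close> 60)

abbreviation V :: "string \<Rightarrow> nexp" where
  "V x \<equiv> NGet x (NNum 0)"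

abbreviation When :: "bexp \<Rightarrow> com \<Rightarrow> com" where
  "When b c \<equiv> Cond b c Skip"

text \<open>The bound \<open>e\<close> is evaluated anew at each test, which is why
  \<open>runs_For\<close> asks for its value to be constant throughout the loop.\<close>

definition For :: "string \<Rightarrow> nexp \<Rightarrow> com \<Rightarrow> com" where
  "For x e c = NSet x (NNum 0) (NNum 0) ;;
     While (NLess (V x) e) (c ;; NSet x (NNum 0) (NAdd (V x) (NNum 1)))"

lemma nmem_nset [simp]: "nmem (nset a k v s) = (nmem s)(a := (nmem s a)(k := v))"
  and rmem_nset [simp]: "rmem (nset a k v s) = rmem s"
  and nmem_rset [simp]: "nmem (rset a k w s) = nmem s"
  and rmem_rset [simp]: "rmem (rset a k w s) = (rmem s)(a := (rmem s a)(k := w))"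
  by (simp_all add: nset_def rset_def)

section \<open>Frames: which arrays a program leaves untouched\<close>

fun nwrites :: "com \<Rightarrow> string set" where
  "nwrites Skip = {}"
| "nwrites (NSet a k e) = {a}"
| "nwrites (RSet a k e) = {}"
| "nwrites (Seq c1 c2) = nwrites c1 \<union> nwrites c2"
| "nwrites (Cond b c1 c2) = nwrites c1 \<union> nwrites c2"
| "nwrites (While b c) = nwrites c"

fun rwrites :: "com \<Rightarrow> string set" where
  "rwrites Skip = {}"
| "rwrites (NSet a k e) = {}"
| "rwrites (RSet a k e) = {a}"
| "rwrites (Seq c1 c2) = rwrites c1 \<union> rwrites c2"
| "rwrites (Cond b c1 c2) = rwrites c1 \<union> rwrites c2"
| "rwrites (While b c) = rwrites c"

lemma nwrites_For [simp]: "nwrites (For x e c) = insert x (nwrites c)"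
  and rwrites_For [simp]: "rwrites (For x e c) = rwrites c"
  by (auto simp: For_def)

text \<open>A syntactic frame condition on whole arrays. It spares the loop invariants all mention
  of data that the loop does not write.\<close>

definition frame :: "com \<Rightarrow> mem \<Rightarrow> mem \<Rightarrow> bool" where
  "frame c s s' \<longleftrightarrow> (\<forall>a. a \<notin> nwrites c \<longrightarrow> nmem s' a = nmem s a) \<and>
                   (\<forall>a. a \<notin> rwrites c \<longrightarrow> rmem s' a = rmem s a)"

lemma frame_nmem: "frame c s s' \<Longrightarrow> a \<notin> nwrites c \<Longrightarrow> nmem s' a = nmem s a"
  and frame_rmem: "frame c s s' \<Longrightarrow> a \<notin> rwrites c \<Longrightarrow> rmem s' a = rmem s a"
  by (simp_all add: frame_def)

lemma frame_refl [simp]: "frame c s s"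
  by (simp add: frame_def)

lemma frame_trans: "frame c s s' \<Longrightarrow> frame c s' s'' \<Longrightarrow> frame c s s''"
  by (simp add: frame_def)

lemma frame_weaken:
  "frame c s s' \<Longrightarrow> nwrites c \<subseteq> nwrites d \<Longrightarrow> rwrites c \<subseteq> rwrites d \<Longrightarrow> frame d s s'"
  by (auto simp: frame_def)

lemma exec_frame: "exec c s t s' \<Longrightarrow> frame c s s'"
  by (induction rule: exec.induct) (auto simp: frame_def)

section \<open>Total correctness with time bounds\<close>

text \<open>Since \<open>exec\<close> is deterministic (\<open>exec_deterministic\<close>), the
  existential quantifier speaks of the only execution.\<close>

definition runs :: "com \<Rightarrow> mem \<Rightarrow> nat \<Rightarrow> (mem \<Rightarrow> bool) \<Rightarrow> bool" where
  "runs c s T Q \<longleftrightarrow> (\<exists>t s'. exec c s t s' \<and> t \<le> T \<and> Q s')"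

lemma runs_frame:
  "runs c s T Q \<Longrightarrow> (\<And>s'. frame c s s' \<Longrightarrow> Q s' \<Longrightarrow> R s') \<Longrightarrow> T \<le> T' \<Longrightarrow> runs c s T' R"
  unfolding runs_def by (meson exec_frame le_trans)

lemma runs_Seq:
  "runs c1 s Ta R \<Longrightarrow> (\<And>s'. frame c1 s s' \<Longrightarrow> R s' \<Longrightarrow> runs c2 s' Tb Q) \<Longrightarrow> Ta + Tb \<le> T \<Longrightarrow>
    runs (c1 ;; c2) s T Q"
  unfolding runs_def by (meson exec_frame exec.Seq add_mono le_trans)

text \<open>The measure bounds the number of iterations. Each pays \<open>K\<close> for the body and
  1 for the test; the last 1 is the failing test.\<close>

lemma runs_While:
  assumes "I s0"
    and step: "\<And>s. frame c s0 s \<Longrightarrow> I s \<Longrightarrow> bval b s \<Longrightarrow>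
      runs c s K (\<lambda>s'. I s' \<and> (\<mu> s' :: nat) < \<mu> s)"
  shows "runs (While b c) s0 (\<mu> s0 * (K + 1) + 1) (\<lambda>s. I s \<and> \<not> bval b s)"
proof -
  have "runs (While b c) s (\<mu> s * (K + 1) + 1) (\<lambda>s. I s \<and> \<not> bval b s)"
    if "frame c s0 s" "I s" for s
    using that
  proof (induction "\<mu> s" arbitrary: s rule: less_induct)
    case less
    show ?case
    proof (cases "bval b s")
      case True
      from step[OF less.prems True] obtain t1 s1
        where 1: "exec c s t1 s1" "t1 \<le> K" "I s1" "\<mu> s1 < \<mu> s" by (auto simp: runs_def)
      from less.hyps[OF 1(4) frame_trans[OF less.prems(1) exec_frame[OF 1(1)]] 1(3)]
      obtain t2 s2
        where 2: "exec (While b c) s1 t2 s2" "t2 \<le> \<mu> s1 * (K + 1) + 1" "I s2" "\<not> bval b s2"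
        unfolding runs_def by blast
      from 1(4) have "\<mu> s1 * (K + 1) + (K + 1) \<le> \<mu> s * (K + 1)"
        by (metis Suc_leI add.commute mult_Suc mult_le_mono1)
      with 1(2) 2(2) have "1 + t1 + t2 \<le> \<mu> s * (K + 1) + 1" by linarith
      with exec.WhileTrue[OF True 1(1) 2(1)] 2(3,4) show ?thesis by (auto simp: runs_def)
    next
      case False
      with less.prems exec.WhileFalse[OF False, of c] show ?thesis
        unfolding runs_def by fastforce
    qed
  qed
  with assms(1) show ?thesis by simp
qed

text \<open>Each iteration pays \<open>K\<close> for the body, 1 for the increment and 1 for the
  test; the final 2 is the initial assignment and the failing test. \<open>N\<close> is the actual
  number of iterations and \<open>M\<close> a uniform bound, so that inner loops of varying length
  get the same time.\<close>

lemma runs_For: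
  assumes x: "x \<notin> nwrites c"
    and I0: "I 0 (nset x 0 0 s0)"
    and bound: "\<And>s. frame (For x e c) s0 s \<Longrightarrow> nval e s = N"
    and step: "\<And>k s. k < N \<Longrightarrow> frame (For x e c) s0 s \<Longrightarrow> nmem s x 0 = k \<Longrightarrow> I k s \<Longrightarrow>
      runs c s K (\<lambda>s'. I (Suc k) (nset x 0 (Suc k) s'))"
    and M: "N \<le> M"
  shows "runs (For x e c) s0 (M * (K + 2) + 2) (I N)"
proof -
  let ?F = "For x e c" and ?s = "nset x 0 0 s0"
  let ?W = "While (NLess (V x) e) (c ;; NSet x (NNum 0) (NAdd (V x) (NNum 1)))"
  let ?I = "\<lambda>s. frame ?F s0 s \<and> nmem s x 0 \<le> N \<and> I (nmem s x 0) s"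
  have e: "nval e s = N" if "?I s" for s
    using bound that by blast
  have I: "?I ?s"
    using I0 by (auto simp: frame_def)
  have "runs ?W ?s ((N - nmem ?s x 0) * (K + 1 + 1) + 1)
      (\<lambda>s. ?I s \<and> \<not> bval (NLess (V x) e) s)"
  proof (rule runs_While)
    fix s assume s: "?I s" and "bval (NLess (V x) e) s"
    with e[OF s] have less: "nmem s x 0 < N" by simp
    from s have "runs c s K (\<lambda>s'. I (Suc (nmem s x 0)) (nset x 0 (Suc (nmem s x 0)) s'))"
      by (intro step[OF less]) auto
    then obtain t s' where 1: "exec c s t s'" "t \<le> K"
        "I (Suc (nmem s x 0)) (nset x 0 (Suc (nmem s x 0)) s')"
      by (auto simp: runs_def)
    from exec_frame[OF 1(1)] have fr: "frame ?F s s'" by (rule frame_weaken) auto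
    from frame_nmem[OF exec_frame[OF 1(1)] x] have x': "nmem s' x 0 = nmem s x 0" by simp
    let ?s' = "nset x 0 (Suc (nmem s x 0)) s'"
    have "frame ?F s0 ?s'"
      using s fr by (auto simp: frame_def)
    moreover have "exec (c ;; NSet x (NNum 0) (NAdd (V x) (NNum 1))) s (t + 1) ?s'"
      using exec.Seq[OF 1(1) exec.NSet[of x "NNum 0" "NAdd (V x) (NNum 1)" s']] x' by simp
    ultimately show "runs (c ;; NSet x (NNum 0) (NAdd (V x) (NNum 1))) s (K + 1)
        (\<lambda>s'. ?I s' \<and> N - nmem s' x 0 < N - nmem s x 0)"
      unfolding runs_def using 1(2,3) less by (intro exI[of _ "t + 1"] exI[of _ ?s']) auto
  qed (fact I)
  then obtain t s where *: "exec ?W ?s t s" "t \<le> N * (K + 1 + 1) + 1" "?I s"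
      "\<not> bval (NLess (V x) e) s"
    by (auto simp: runs_def)
  from *(3,4) e[OF *(3)] have "I N s" by auto
  moreover have "exec ?F s0 (1 + t) s"
    unfolding For_def using exec.Seq[OF exec.NSet[of x "NNum 0" "NNum 0" s0]] *(1) by simp
  moreover have "1 + t \<le> M * (K + 2) + 2"
    using *(2) mult_le_mono1[OF M, of "K + 2"] by simp
  ultimately show ?thesis unfolding runs_def by blast
qed

section \<open>Loop-free programs, evaluated symbolically\<close>

fun loopfree :: "com \<Rightarrow> bool" where
  "loopfree (Seq c1 c2) \<longleftrightarrow> loopfree c1 \<and> loopfree c2"
| "loopfree (Cond b c1 c2) \<longleftrightarrow> loopfree c1 \<and> loopfree c2"
| "loopfree (While b c) \<longleftrightarrow> False"
| "loopfree _ \<longleftrightarrow> True"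

fun cost :: "com \<Rightarrow> nat" where
  "cost (Seq c1 c2) = cost c1 + cost c2"
| "cost (Cond b c1 c2) = 1 + max (cost c1) (cost c2)"
| "cost _ = 1"

text \<open>The value at loops is irrelevant: \<open>sem\<close> is used for loop-free programs only.\<close>

fun sem :: "com \<Rightarrow> mem \<Rightarrow> mem" where
  "sem Skip s = s"
| "sem (NSet a k e) s = nset a (nval k s) (nval e s) s"
| "sem (RSet a k e) s = rset a (nval k s) (rval e s) s"
| "sem (Seq c1 c2) s = sem c2 (sem c1 s)"
| "sem (Cond b c1 c2) s = (if bval b s then sem c1 s else sem c2 s)"
| "sem (While b c) s = s"

lemma exec_loopfree: "loopfree c \<Longrightarrow> \<exists>t \<le> cost c. exec c s t (sem c s)"
proof (induction c arbitrary: s)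
  case (Seq c1 c2)
  then obtain t1 t2 where "t1 \<le> cost c1" "exec c1 s t1 (sem c1 s)"
    "t2 \<le> cost c2" "exec c2 (sem c1 s) t2 (sem c2 (sem c1 s))"
    by (metis loopfree.simps(1))
  then show ?case by (auto intro!: exI[of _ "t1 + t2"] exec.Seq)
next
  case (Cond b c1 c2)
  show ?case
  proof (cases "bval b s")
    case True
    from Cond obtain t where "t \<le> cost c1" "exec c1 s t (sem c1 s)" by auto
    with True exec.CondTrue[OF True this(2), of c2] show ?thesis
      by (intro exI[of _ "1 + t"]) auto
  next
    case False
    from Cond obtain t where "t \<le> cost c2" "exec c2 s t (sem c2 s)" by auto
    with False exec.CondFalse[OF False this(2), of c1] show ?thesis
      by (intro exI[of _ "1 + t"]) auto
  qed
next
  case Skip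
  show ?case using exec.Skip[of s] by (intro exI[of _ 1]) simp
next
  case (NSet a k e)
  show ?case using exec.NSet[of a k e s] by (intro exI[of _ 1]) simp
next
  case (RSet a k e)
  show ?case using exec.RSet[of a k e s] by (intro exI[of _ 1]) simp
qed simp

lemma runs_loopfree: "loopfree c \<Longrightarrow> Q (sem c s) \<Longrightarrow> cost c \<le> T \<Longrightarrow> runs c s T Q"
  unfolding runs_def by (meson exec_loopfree le_trans)

section \<open>The programs\<close>

text \<open>The machine cannot multiply, so the row offsets \<open>i * n\<close> and
  \<open>i * m\<close> are tabulated by repeated addition.\<close>

definition index_rows :: com where
  "index_rows = For ''i'' (V ''n'')
    (NSet ''rn'' (NAdd (V ''i'') (NNum 1)) (NAdd (NGet ''rn'' (V ''i'')) (V ''n'')) ;;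
     NSet ''rm'' (NAdd (V ''i'') (NNum 1)) (NAdd (NGet ''rm'' (V ''i'')) (V ''m'')))"

text \<open>An undecided node without neighbours settles the answer negatively. The sums computed
  later cannot reveal it: they stay 0 there, below the positive threshold.\<close>

definition find_sources :: com where
  "find_sources = For ''i'' (V ''n'')
    (NSet ''fed'' (NNum 0) (NNum 0) ;;
     For ''j'' (V ''n'')
       (When (NLess (NNum 0) (NGet ''edge'' (NAdd (NGet ''rn'' (V ''j'')) (V ''i''))))
         (NSet ''fed'' (NNum 0) (NNum 1))) ;;
     When (BAnd (NLess (V ''fed'') (NNum 1)) (NLess (NNum 1) (NGet ''size'' (V ''i''))))
       (NSet ''bad'' (NNum 0) (NNum 1)))"

abbreviation (input) listed :: nexp where
  "listed \<equiv> NGet ''prod'' (NAdd (NGet ''rm'' (V ''i'')) (V ''k''))"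

text \<open>Turns the lists into a bit matrix, so that \<open>inform\<close> can test membership in
  constant time.\<close>

definition mark_products :: com where
  "mark_products = For ''i'' (V ''n'')
    (For ''k'' (NGet ''size'' (V ''i''))
      (NSet ''member'' (NAdd (NGet ''rm'' (V ''i'')) listed) (NNum 1)))"

definition enqueue :: "nexp \<Rightarrow> nexp \<Rightarrow> com" where
  "enqueue i t =
    NSet ''adopted'' i (NNum 1) ;;
    NSet ''choice'' i t ;;
    NSet ''queue'' (V ''tail'') i ;;
    NSet ''tail'' (NNum 0) (NAdd (V ''tail'') (NNum 1))"

definition seed_queue :: com where
  "seed_queue = For ''i'' (V ''n'')
    (When (NLess (NGet ''size'' (V ''i'')) (NNum 2))
      (enqueue (V ''i'') (NGet ''prod'' (NGet ''rm'' (V ''i'')))))"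

text \<open>Sums change only here, so testing the threshold right after the addition catches every
  adoption as soon as the counted weight permits it. Sums also keep growing at nodes that have
  already adopted, because \<open>find_conflicts\<close> inspects them.\<close>

definition inform :: com where
  "inform =
    (let edge = NAdd (NGet ''rn'' (V ''cur'')) (V ''j'');
         cell = NAdd (NGet ''rm'' (V ''j'')) (V ''t'')
     in When (NLess (NNum 0) (NGet ''edge'' edge))
       (RSet ''sum'' cell (RAdd (RGet ''sum'' cell) (RGet ''weight'' edge)) ;;
        When (BAnd (NLess (NGet ''adopted'' (V ''j'')) (NNum 1))
               (BAnd (NLess (NNum 0) (NGet ''member'' cell))
                 (BNot (RLess (RGet ''sum'' cell) (RGet ''threshold'' (V ''j''))))))
          (enqueue (V ''j'') (V ''t''))))"

definition propagate :: com where
  "propagate = While (NLess (V ''head'') (V ''tail''))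
    (NSet ''cur'' (NNum 0) (NGet ''queue'' (V ''head'')) ;;
     NSet ''t'' (NNum 0) (NGet ''choice'' (V ''cur'')) ;;
     For ''j'' (V ''n'') inform ;;
     NSet ''head'' (NNum 0) (NAdd (V ''head'') (NNum 1)))"

text \<open>With truncated subtraction, the sum of the two differences is positive exactly if the
  numbers differ. At an undecided node the entry of \<open>choice\<close> is meaningless but
  harmless: the sums of its own products are below the threshold there.\<close>

definition find_conflicts :: com where
  "find_conflicts = For ''i'' (V ''n'')
    (For ''k'' (NGet ''size'' (V ''i''))
      (When (BAnd (NLess (NNum 1) (NGet ''size'' (V ''i'')))
              (BAnd (BNot (RLess (RGet ''sum'' (NAdd (NGet ''rm'' (V ''i'')) listed))
                                 (RGet ''threshold'' (V ''i''))))
                (NLess (NNum 0) (NAdd (NSub listed (NGet ''choice'' (V ''i'')))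
                                      (NSub (NGet ''choice'' (V ''i'')) listed)))))
        (NSet ''bad'' (NNum 0) (NNum 1))))"

definition answer :: com where
  "answer = NSet ''result'' (NNum 0) (NSub (NNum 1) (V ''bad''))"

definition decide :: com where
  "decide = index_rows ;; find_sources ;; mark_products ;; seed_queue ;; propagate ;;
    find_conflicts ;; answer"

definition decide_large_thresholds :: com where
  "decide_large_thresholds = index_rows ;; find_sources ;; answer"

lemmas program_defs = index_rows_def find_sources_def mark_products_def enqueue_def seed_queue_def
  inform_def propagate_def find_conflicts_def

section \<open>Propagation of adoptions through a queue\<close>

locale network_input =
  fixes n m :: nat and S :: "(nat, nat) setting" and p :: "nat \<Rightarrow> nat set"
    and ps :: "nat \<Rightarrow> nat list"
  assumes valid: "valid_setting S" and nodes: "nodes S = {..<n}" and products: "products S = {..<m}"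
    and p: "p \<in> social_networks S"
    and ps: "\<And>i. i < n \<Longrightarrow> distinct (ps i) \<and> set (ps i) = p i"
begin

lemma p_subset: "i < n \<Longrightarrow> p i \<subseteq> {..<m}"
  and p_nonempty: "i < n \<Longrightarrow> p i \<noteq> {}"
  using p by (auto simp: social_networks_def nodes products PiE_def Pi_def)

lemma p_less: "i < n \<Longrightarrow> t \<in> p i \<Longrightarrow> t < m"
  using p_subset by blast

lemma card_p_le: "i < n \<Longrightarrow> card (p i) \<le> m"
  using card_mono[OF _ p_subset] by simp

lemma card_p_pos: "i < n \<Longrightarrow> 0 < card (p i)"
  using p_subset p_nonempty finite_subset[of "p i" "{..<m}"] by (simp add: card_gt_0_iff)

lemma length_ps: "i < n \<Longrightarrow> length (ps i) = card (p i)"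
  using ps distinct_card by fastforce

lemma row_eq_iff: "t < m \<Longrightarrow> u < m \<Longrightarrow> i * m + t = j * m + u \<longleftrightarrow> i = j \<and> t = u"
  by (metis add.commute add_left_cancel div_less div_mult_self1 less_nat_zero_code add_0)

lemma neighbours_less: "i \<in> neighbours S j \<Longrightarrow> i < n"
  using neighbours_subset[OF valid, of j] nodes by auto

section \<open>Networks, queues and sums as represented in memory\<close>

definition net :: "(nat \<Rightarrow> nat) \<Rightarrow> (nat \<Rightarrow> nat) \<Rightarrow> nat \<Rightarrow> nat set" where
  "net ad prd i = (if i < n \<and> 0 < ad i then {prd i} else p i)"

text \<open>
  \<open>sent h k q i j\<close>: node \<open>i\<close> has already announced its choice to node \<open>j\<close>, where \<open>h\<close> entries of
  the queue \<open>q\<close> are finished and the next one has been announced to the nodes below \<open>k\<close>.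
\<close>

definition sent :: "nat \<Rightarrow> nat \<Rightarrow> (nat \<Rightarrow> nat) \<Rightarrow> nat \<Rightarrow> nat \<Rightarrow> bool" where
  "sent h k q i j \<longleftrightarrow> i \<in> q ` {..<h} \<or> i = q h \<and> j < k"

definition senders :: "nat \<Rightarrow> nat \<Rightarrow> (nat \<Rightarrow> nat) \<Rightarrow> (nat \<Rightarrow> nat) \<Rightarrow> nat \<Rightarrow> nat \<Rightarrow> nat set" where
  "senders h k prd q j t = {i \<in> neighbours S j. sent h k q i j \<and> prd i = t}"

definition queued :: "(nat \<Rightarrow> nat) \<Rightarrow> (nat \<Rightarrow> nat) \<Rightarrow> nat \<Rightarrow> bool" where
  "queued ad q e \<longleftrightarrow> q ` {..<e} = {i. i < n \<and> 0 < ad i} \<and> inj_on q {..<e}"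

text \<open>The invariant of propagation. Nodes with a singleton in \<open>p\<close> count as
  adopters from the start. Sums cover only announcements already made; for \<open>h = e\<close>
  these are the announcements of all adopters, and the sums become those of the adoption
  conditions.\<close>

definition propagated ::
    "nat \<Rightarrow> nat \<Rightarrow> (nat \<Rightarrow> nat) \<Rightarrow> (nat \<Rightarrow> nat) \<Rightarrow> (nat \<Rightarrow> nat) \<Rightarrow> nat \<Rightarrow> (nat \<Rightarrow> real) \<Rightarrow> bool" where
  "propagated h k ad prd q e W \<longleftrightarrow>
     h \<le> e \<and> queued ad q e \<and> (reduces S)\<^sup>*\<^sup>* p (net ad prd) \<and>
     (\<forall>i<n. 0 < ad i \<longrightarrow> prd i \<in> p i) \<and>
     (\<forall>i<n. card (p i) < 2 \<longrightarrow> 0 < ad i) \<and>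
     (\<forall>j<n. \<forall>t<m. W (j * m + t) = (\<Sum>i \<in> senders h k prd q j t. weight S i j)) \<and>
     (\<forall>j<n. ad j = 0 \<longrightarrow> (\<forall>t \<in> p j. W (j * m + t) < threshold S j))"

lemma finite_senders: "finite (senders h k prd q j t)"
  unfolding senders_def using finite_neighbours[OF valid] by simp

text \<open>A node enters the queue at most once. Hence there are at most \<open>n\<close> rounds of
  announcements, which gives the quadratic time.\<close>

lemma queue_length_le: "queued ad q e \<Longrightarrow> e \<le> n"
proof -
  assume q: "queued ad q e"
  then have "card (q ` {..<e}) \<le> card {..<n}" by (intro card_mono) (auto simp: queued_def)
  moreover have "card (q ` {..<e}) = e" using q card_image[of q "{..<e}"] unfolding queued_def by simp
  ultimately show ?thesis by simp
qed

lemma queue_entry: "queued ad q e \<Longrightarrow> h < e \<Longrightarrow> q h < n \<and> 0 < ad (q h)"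
  by (auto simp: queued_def)

lemma queue_entry_fresh: "queued ad q e \<Longrightarrow> h < e \<Longrightarrow> q h \<notin> q ` {..<h}"
  by (fastforce simp: queued_def dest: inj_onD)

lemma sent_adopted: "queued ad q e \<Longrightarrow> h < e \<Longrightarrow> sent h k q i j \<Longrightarrow> i < n \<and> 0 < ad i"
  using queue_entry by (fastforce simp: sent_def)

text \<open>Before any announcement all sums are 0, and thresholds are positive.\<close>

lemma propagated_init:
  assumes "queued ad q e"
    and ad: "\<And>i. i < n \<Longrightarrow> 0 < ad i \<longleftrightarrow> card (p i) < 2"
    and prd: "\<And>i. i < n \<Longrightarrow> card (p i) < 2 \<Longrightarrow> p i = {prd i}"
  shows "propagated 0 0 ad prd q e (\<lambda>_. 0)"
proof -
  have "net ad prd = p" using ad prd by (auto simp: net_def fun_eq_iff)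
  then show ?thesis
    using assms valid unfolding propagated_def
    by (auto simp: senders_def sent_def valid_setting_def nodes)
qed

lemma propagated_next_row: "propagated h n ad prd q e W \<Longrightarrow> h < e \<Longrightarrow> propagated (Suc h) 0 ad prd q e W"
proof -
  assume *: "propagated h n ad prd q e W" "h < e"
  have "senders h n prd q j t = senders (Suc h) 0 prd q j t" if "j < n" for j t
    using that by (auto simp: senders_def sent_def lessThan_Suc)
  with * show ?thesis unfolding propagated_def by auto
qed

text \<open>The queue has no repetitions, so \<open>q h\<close> is a new sender and its weight is
  counted only once.\<close>

lemma senders_Suc:
  assumes "queued ad q e" "h < e"
  shows "senders h (Suc k) prd q j t =
      (if j = k \<and> (q h, k) \<in> edges S \<and> prd (q h) = t then insert (q h) (senders h k prd q j t)
       else senders h k prd q j t)"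
    and "q h \<notin> senders h k prd q k t"
  using queue_entry_fresh[OF assms]
  by (auto simp: senders_def sent_def neighbours_def less_Suc_eq)

lemma propagated_skip:
  "propagated h k ad prd q e W \<Longrightarrow> h < e \<Longrightarrow> (q h, k) \<notin> edges S \<Longrightarrow> propagated h (Suc k) ad prd q e W"
  unfolding propagated_def by (auto simp: senders_Suc)

definition bump :: "nat \<Rightarrow> nat \<Rightarrow> nat \<Rightarrow> (nat \<Rightarrow> real) \<Rightarrow> nat \<Rightarrow> real" where
  "bump i k t W = W(k * m + t := W (k * m + t) + weight S i k)"

lemma bump_sum:
  assumes P: "propagated h k ad prd q e W" and h: "h < e" and edge: "(q h, k) \<in> edges S"
    and j: "j < n" "t < m"
  shows "bump (q h) k (prd (q h)) W (j * m + t) = (\<Sum>i \<in> senders h (Suc k) prd q j t. weight S i j)"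
proof -
  from P have q: "queued ad q e" and W: "W (j * m + t) = (\<Sum>i \<in> senders h k prd q j t. weight S i j)"
    using j by (auto simp: propagated_def)
  from P queue_entry[OF q h] have "prd (q h) < m"
    using p_less by (auto simp: propagated_def)
  with j have eq: "j * m + t = k * m + prd (q h) \<longleftrightarrow> j = k \<and> prd (q h) = t"
    by (auto simp: row_eq_iff)
  show ?thesis
    using W edge eq
    by (auto simp: bump_def senders_Suc[OF q h] sum.insert[OF finite_senders] senders_Suc(2)[OF q h])
qed

lemma propagated_inform:
  assumes P: "propagated h k ad prd q e W" and h: "h < e" and k: "k < n" and edge: "(q h, k) \<in> edges S"
    and W': "W' = bump (q h) k (prd (q h)) W"
    and no: "\<not> (ad k = 0 \<and> prd (q h) \<in> p k \<and> threshold S k \<le> W' (k * m + prd (q h)))"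
  shows "propagated h (Suc k) ad prd q e W'"
proof -
  have "W' (j * m + t) < threshold S j" if j: "j < n" "ad j = 0" "t \<in> p j" for j t
  proof (cases "j * m + t = k * m + prd (q h)")
    case True
    from P queue_entry[of ad q e h] h have "prd (q h) < m"
      using p_less by (auto simp: propagated_def)
    with True j p_less have "j = k" "prd (q h) = t" by (auto simp: row_eq_iff)
    with no j show ?thesis by auto
  next
    case False
    with P j show ?thesis by (simp add: W' bump_def propagated_def)
  qed
  moreover have "\<forall>j<n. \<forall>t<m. W' (j * m + t) = (\<Sum>i \<in> senders h (Suc k) prd q j t. weight S i j)"
    using bump_sum[OF P h edge] W' by simp
  ultimately show ?thesis using P unfolding propagated_def by simp
qed

text \<open>The new adopter \<open>k\<close> has announced nothing yet, so recording its choice and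
  appending it to the queue alters no set of senders.\<close>

lemma propagated_adopt:
  assumes P: "propagated h k ad prd q e W" and h: "h < e" and k: "k < n" and edge: "(q h, k) \<in> edges S"
    and W': "W' = bump (q h) k (prd (q h)) W"
    and new: "ad k = 0" "prd (q h) \<in> p k" "threshold S k \<le> W' (k * m + prd (q h))"
  shows "propagated h (Suc k) (ad(k := 1)) (prd(k := prd (q h))) (q(e := k)) (Suc e) W'"
proof -
  let ?t = "prd (q h)" and ?ad = "ad(k := 1)" and ?prd = "prd(k := prd (q h))" and ?q = "q(e := k)"
  from P have q: "queued ad q e" and reach: "(reduces S)\<^sup>*\<^sup>* p (net ad prd)"
    by (auto simp: propagated_def)
  have sum: "W' (j * m + t) = (\<Sum>i \<in> senders h (Suc k) prd q j t. weight S i j)" if "j < n" "t < m" for j t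
    using bump_sum[OF P h edge that] W' by simp
  have queued: "queued ?ad ?q (Suc e)"
  proof -
    have "k \<notin> q ` {..<e}" using q new(1) by (auto simp: queued_def)
    moreover have "?q ` {..<e} = q ` {..<e}" by auto
    moreover have "inj_on ?q {..<e}" using q by (auto simp: queued_def inj_on_def)
    ultimately show ?thesis
      using q k by (auto simp: queued_def lessThan_Suc)
  qed
  have ne: "i \<noteq> k" if "sent h (Suc k) q i j" for i j
    using sent_adopted[OF q h that] new(1) by auto
  have "sent h (Suc k) ?q i j = sent h (Suc k) q i j" for i j
    using h by (auto simp: sent_def)
  with ne have senders: "senders h (Suc k) ?prd ?q j t = senders h (Suc k) prd q j t" for j t
    by (auto simp: senders_def)
  have card: "2 \<le> card (p k)" using P new(1) k by (auto simp: propagated_def not_less[symmetric])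
  have "adoptable S (net ad prd) ?t k"
  proof -
    have "threshold S k \<le> (\<Sum>i \<in> senders h (Suc k) prd q k ?t. weight S i k)"
      using new sum[OF k p_less[OF k new(2)]] by simp
    \<comment> \<open>Only an inequality: supporters still waiting in the queue are not yet
      counted.\<close>
    also have "\<dots> \<le> (\<Sum>i \<in> {i \<in> neighbours S k. net ad prd i = {?t}}. weight S i k)"
    proof (rule sum_mono2)
      show "senders h (Suc k) prd q k ?t \<subseteq> {i \<in> neighbours S k. net ad prd i = {?t}}"
        by (auto simp: senders_def net_def dest!: sent_adopted[OF q h])
    qed (use finite_neighbours[OF valid] weight_nonneg[OF valid] in auto)
    finally show ?thesis by (auto simp: adoptable_def)
  qed
  moreover have "net ad prd k = p k" using new(1) by (simp add: net_def)
  ultimately have "reduces S (net ad prd) ((net ad prd)(k := {?t}))"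
    using reaches_social_networks[OF reach p] nodes k card new(2) by (intro reduces_upd) auto
  moreover have "net ?ad ?prd = (net ad prd)(k := {?t})"
    using k by (auto simp: net_def fun_eq_iff)
  ultimately have "(reduces S)\<^sup>*\<^sup>* p (net ?ad ?prd)"
    using reach by (simp add: rtranclp.rtrancl_into_rtrancl)
  moreover have "W' (j * m + t) < threshold S j" if j: "j < n" "?ad j = 0" "t \<in> p j" for j t
  proof -
    from j have "j \<noteq> k" by auto
    then have "j * m + t \<noteq> k * m + ?t"
      using j p_less new(2) k by (auto simp: row_eq_iff)
    with P j \<open>j \<noteq> k\<close> show ?thesis by (simp add: W' bump_def propagated_def)
  qed
  ultimately show ?thesis
    using P queued sum new(2) unfolding propagated_def senders by auto
qed

text \<open>With the queue exhausted, the right-hand side is the stability required by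
  \<open>unique_outcomeI\<close>. A violation at \<open>i\<close> gives two reachable choices for
  \<open>i\<close>, by \<open>adoptable_reached\<close>.\<close>

lemma unique_outcome_iff_propagated:
  assumes P: "propagated e 0 ad prd q e W"
    and nosource: "\<And>i. i < n \<Longrightarrow> 2 \<le> card (p i) \<Longrightarrow> neighbours S i \<noteq> {}"
  shows "unique_outcome S p \<longleftrightarrow>
    (\<forall>i<n. 2 \<le> card (p i) \<longrightarrow> (\<forall>t \<in> p i. threshold S i \<le> W (i * m + t) \<longrightarrow> t = prd i))"
proof -
  from P have reach: "(reduces S)\<^sup>*\<^sup>* p (net ad prd)" by (simp add: propagated_def)
  have adoptable: "adoptable S (net ad prd) t i \<longleftrightarrow> threshold S i \<le> W (i * m + t)"
    if i: "i < n" "2 \<le> card (p i)" "t \<in> p i" for i t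
  proof -
    have "{j \<in> neighbours S i. net ad prd j = {t}} = senders e 0 prd q i t"
    proof -
      have "net ad prd j = {t} \<longleftrightarrow> sent e 0 q j i \<and> prd j = t" if "j < n" for j
      proof -
        have "card (p j) < 2" if "p j = {t}" using that by simp
        with P \<open>j < n\<close> have "p j = {t} \<Longrightarrow> 0 < ad j" unfolding propagated_def by blast
        moreover have "sent e 0 q j i \<longleftrightarrow> 0 < ad j"
          using P \<open>j < n\<close> by (auto simp: sent_def propagated_def queued_def)
        ultimately show ?thesis using \<open>j < n\<close> by (auto simp: net_def)
      qed
      then show ?thesis using neighbours_less by (auto simp: senders_def)
    qed
    with P i nosource[OF i(1,2)] p_less[OF i(1,3)] show ?thesis
      by (simp add: adoptable_def propagated_def)
  qed
  \<comment> \<open>By the last clause of \<open>propagated\<close>, a node that has not adopted is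
    below its threshold for all of its products.\<close>
  have adopted: "net ad prd i = {prd i}"
    if "i < n" "t \<in> p i" "threshold S i \<le> W (i * m + t)" for i t
    using P that by (fastforce simp: net_def propagated_def)
  show ?thesis
  proof
    assume unique: "unique_outcome S p"
    show "\<forall>i<n. 2 \<le> card (p i) \<longrightarrow> (\<forall>t \<in> p i. threshold S i \<le> W (i * m + t) \<longrightarrow> t = prd i)"
    proof (intro allI impI ballI)
      fix i t assume i: "i < n" "2 \<le> card (p i)" "t \<in> p i" "threshold S i \<le> W (i * m + t)"
      then obtain r where "(reduces S)\<^sup>*\<^sup>* p r" "r i = {t}"
        using adoptable_reached[OF valid p reach, of i t] adoptable[OF i(1-3)] nodes by auto
      with reach adopted[OF i(1,3,4)] unique not_unique_outcome[OF valid] show "t = prd i" by blast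
    qed
  next
    assume "\<forall>i<n. 2 \<le> card (p i) \<longrightarrow> (\<forall>t \<in> p i. threshold S i \<le> W (i * m + t) \<longrightarrow> t = prd i)"
    with adoptable adopted nodes show "unique_outcome S p"
      by (intro unique_outcomeI[OF valid p reach]) auto
  qed
qed

section \<open>Correctness and running time of the programs\<close>

definition loaded :: "mem \<Rightarrow> bool" where
  "loaded s \<longleftrightarrow> nmem s ''n'' 0 = n \<and> nmem s ''m'' 0 = m \<and>
     (\<forall>i<n. \<forall>j<n. 0 < nmem s ''edge'' (i * n + j) \<longleftrightarrow> (i, j) \<in> edges S) \<and>
     (\<forall>i<n. nmem s ''size'' i = card (p i)) \<and>
     (\<forall>i<n. \<forall>k<card (p i). nmem s ''prod'' (i * m + k) = ps i ! k) \<and>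
     (\<forall>i<n. \<forall>j<n. (i, j) \<in> edges S \<longrightarrow> rmem s ''weight'' (i * n + j) = weight S i j) \<and>
     (\<forall>i<n. rmem s ''threshold'' i = threshold S i)"

definition indexed :: "mem \<Rightarrow> bool" where
  "indexed s \<longleftrightarrow> loaded s \<and> (\<forall>i<n. nmem s ''rn'' i = i * n \<and> nmem s ''rm'' i = i * m)"

abbreviation inputs :: "string set" where
  "inputs \<equiv> {''n'', ''m'', ''edge'', ''size'', ''prod''}"

lemma loaded_frame:
  assumes "loaded s" "frame c s s'" "nwrites c \<inter> inputs = {}"
    "rwrites c \<inter> {''weight'', ''threshold''} = {}"
  shows "loaded s'"
  using assms(1,3,4) frame_nmem[OF assms(2)] frame_rmem[OF assms(2)] by (simp add: loaded_def)

lemma indexed_frame: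
  assumes "indexed s" "frame c s s'" "nwrites c \<inter> ({''rn'', ''rm''} \<union> inputs) = {}"
    "rwrites c \<inter> {''weight'', ''threshold''} = {}"
  shows "indexed s'"
  using assms(1,3,4) frame_nmem[OF assms(2)] loaded_frame[OF _ assms(2)] by (simp add: indexed_def)

lemma indexedD:
  assumes "indexed s"
  shows "nmem s ''n'' 0 = n" "nmem s ''m'' 0 = m"
    and "i < n \<Longrightarrow> nmem s ''rn'' i = i * n"
    and "i < n \<Longrightarrow> nmem s ''rm'' i = i * m"
    and "i < n \<Longrightarrow> j < n \<Longrightarrow> 0 < nmem s ''edge'' (i * n + j) \<longleftrightarrow> (i, j) \<in> edges S"
    and "i < n \<Longrightarrow> nmem s ''size'' i = card (p i)"
    and "i < n \<Longrightarrow> k < card (p i) \<Longrightarrow> nmem s ''prod'' (i * m + k) = ps i ! k"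
    and "i < n \<Longrightarrow> j < n \<Longrightarrow> (i, j) \<in> edges S \<Longrightarrow> rmem s ''weight'' (i * n + j) = weight S i j"
    and "i < n \<Longrightarrow> rmem s ''threshold'' i = threshold S i"
  using assms by (auto simp: indexed_def loaded_def)

lemma loaded_encode: "loaded (encode n m S ps)"
proof -
  have "i * n + j < n * n" if "i < n" "j < n" for i j
  proof -
    have "i * n + j < Suc i * n" using that by simp
    also have "\<dots> \<le> n * n" using that by (intro mult_le_mono1) simp
    finally show ?thesis .
  qed
  moreover have "i * m + k < n * m" "k < m" if "i < n" "k < card (p i)" for i k
  proof -
    show "k < m" using that card_p_le by fastforce
    then have "i * m + k < Suc i * m" by simp
    also have "\<dots> \<le> n * m" using that by (intro mult_le_mono1) simp
    finally show "i * m + k < n * m" .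
  qed
  ultimately show ?thesis
    by (auto simp: loaded_def encode_def length_ps)
qed

lemma runs_index_rows:
  assumes "loaded s0" "nmem s0 ''rn'' 0 = 0" "nmem s0 ''rm'' 0 = 0"
  shows "runs index_rows s0 (n * 4 + 2) indexed"
proof -
  \<comment> \<open>The bound is not strict: iteration \<open>k\<close> fills entry
    \<open>k + 1\<close>, and entry 0 is 0 beforehand.\<close>
  let ?I = "\<lambda>k s. \<forall>i\<le>k. nmem s ''rn'' i = i * n \<and> nmem s ''rm'' i = i * m"
  have loaded: "loaded s" if "frame index_rows s0 s" for s
    using assms(1) that by (rule loaded_frame) (auto simp: program_defs)
  have "runs index_rows s0 (n * (2 + 2) + 2) (?I n)"
    unfolding index_rows_def
  proof (rule runs_For[where I = ?I and N = n], goal_cases)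
    case (3 s)
    then show ?case using loaded[of s] by (simp add: index_rows_def loaded_def)
  next
    case (4 k s)
    then have "nmem s ''n'' 0 = n" "nmem s ''m'' 0 = m"
      using loaded[of s] by (simp_all add: index_rows_def loaded_def)
    with 4 show ?case by (intro runs_loopfree) (auto simp: le_Suc_eq)
  qed (use assms in auto)
  then show ?thesis
    by (rule runs_frame) (use loaded in \<open>auto simp: indexed_def\<close>)
qed

lemma runs_find_sources:
  assumes "indexed s0" "nmem s0 ''bad'' 0 = 0"
  shows "runs find_sources s0 (n * (n * 4 + 7) + 2)
    (\<lambda>s. 0 < nmem s ''bad'' 0 \<longleftrightarrow> (\<exists>i<n. 2 \<le> card (p i) \<and> neighbours S i = {}))"
proof -
  let ?I = "\<lambda>k s. 0 < nmem s ''bad'' 0 \<longleftrightarrow> (\<exists>i<k. 2 \<le> card (p i) \<and> neighbours S i = {})"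
  have "runs find_sources s0 (n * ((1 + ((n * (2 + 2) + 2) + 2)) + 2) + 2) (?I n)"
    unfolding find_sources_def
  proof (rule runs_For[where I = ?I and N = n], goal_cases)
    case (3 s)
    with indexed_frame[OF assms(1) 3] show ?case by (auto simp: indexedD)
  next
    case (4 i s)
    note i = \<open>i < n\<close> \<open>nmem s ''i'' 0 = i\<close>
    have s: "indexed s"
      using indexed_frame[OF assms(1) 4(2)] by auto
    show ?case
    proof (rule runs_Seq[where Tb = "(n * (2 + 2) + 2) + 2"])
      show "runs (NSet ''fed'' (NNum 0) (NNum 0)) s 1 (\<lambda>s. nmem s ''fed'' 0 = 0)"
        by (rule runs_loopfree) auto
    next
      fix s1 assume fr1: "frame (NSet ''fed'' (NNum 0) (NNum 0)) s s1" and "nmem s1 ''fed'' 0 = 0"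
      have s1: "indexed s1" "nmem s1 ''i'' 0 = i" "nmem s1 ''bad'' 0 = nmem s ''bad'' 0"
        using indexed_frame[OF s fr1] frame_nmem[OF fr1] i by auto
      let ?loop = "For ''j'' (V ''n'')
        (When (NLess (NNum 0) (NGet ''edge'' (NAdd (NGet ''rn'' (V ''j'')) (V ''i''))))
         (NSet ''fed'' (NNum 0) (NNum 1)))"
      show "runs (?loop ;;
           When (BAnd (NLess (V ''fed'') (NNum 1)) (NLess (NNum 1) (NGet ''size'' (V ''i''))))
             (NSet ''bad'' (NNum 0) (NNum 1))) s1 ((n * (2 + 2) + 2) + 2)
           (\<lambda>s'. ?I (Suc i) (nset ''i'' 0 (Suc i) s'))"
      proof (rule runs_Seq)
        let ?J = "\<lambda>k s. 0 < nmem s ''fed'' 0 \<longleftrightarrow> (\<exists>j<k. (j, i) \<in> edges S)"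
        show "runs ?loop s1 (n * (2 + 2) + 2) (?J n)"
        proof (rule runs_For[where I = ?J and N = n], goal_cases)
          case (3 s2)
          with indexed_frame[OF s1(1) 3] show ?case by (auto simp: indexedD)
        next
          case (4 j s2)
          have "indexed s2" "nmem s2 ''i'' 0 = i"
            using indexed_frame[OF s1(1) 4(2)] frame_nmem[OF 4(2), of "''i''"] s1 by auto
          with 4 i show ?case
            by (intro runs_loopfree) (auto simp: indexedD less_Suc_eq)
        qed (use \<open>nmem s1 ''fed'' 0 = 0\<close> in auto)
      next
        fix s2 assume fr2: "frame ?loop s1 s2"
          and fed: "0 < nmem s2 ''fed'' 0 \<longleftrightarrow> (\<exists>j<n. (j, i) \<in> edges S)"
        have s2: "indexed s2" "nmem s2 ''i'' 0 = i" "nmem s2 ''bad'' 0 = nmem s ''bad'' 0"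
          using indexed_frame[OF s1(1) fr2] frame_nmem[OF fr2] s1 by auto
        have "nmem s2 ''fed'' 0 = 0 \<longleftrightarrow> neighbours S i = {}"
          using fed neighbours_less[of _ i] by (auto simp: neighbours_def)
        then show "runs (When (BAnd (NLess (V ''fed'') (NNum 1))
             (NLess (NNum 1) (NGet ''size'' (V ''i'')))) (NSet ''bad'' (NNum 0) (NNum 1))) s2 2
           (\<lambda>s'. ?I (Suc i) (nset ''i'' 0 (Suc i) s'))"
          using s2 i 4(4) by (intro runs_loopfree) (auto simp: indexedD less_Suc_eq)
      qed auto
    qed auto
  qed (use assms in auto)
  then show ?thesis by (rule runs_frame) (auto simp: algebra_simps)
qed

lemma runs_mark_products:
  assumes "indexed s0" "nmem s0 ''member'' = (\<lambda>_. 0)"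
  shows "runs mark_products s0 (n * (m * 3 + 4) + 2)
    (\<lambda>s. \<forall>j<n. \<forall>t<m. 0 < nmem s ''member'' (j * m + t) \<longleftrightarrow> t \<in> p j)"
proof -
  let ?I = "\<lambda>i s. \<forall>j<n. \<forall>t<m. 0 < nmem s ''member'' (j * m + t) \<longleftrightarrow> j < i \<and> t \<in> p j"
  have "runs mark_products s0 (n * ((m * (1 + 2) + 2) + 2) + 2) (?I n)"
    unfolding mark_products_def
  proof (rule runs_For[where I = ?I and N = n], goal_cases)
    case (3 s)
    with indexed_frame[OF assms(1) 3] show ?case by (auto simp: indexedD)
  next
    case (4 i s)
    note i = \<open>i < n\<close> \<open>nmem s ''i'' 0 = i\<close>
    have s: "indexed s"
      using indexed_frame[OF assms(1) 4(2)] by auto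
    \<comment> \<open>Rows before \<open>i\<close> are complete, and row \<open>i\<close> holds the
      first \<open>k\<close> listed products.\<close>
    let ?J = "\<lambda>k s. \<forall>j<n. \<forall>t<m. 0 < nmem s ''member'' (j * m + t) \<longleftrightarrow>
      j < i \<and> t \<in> p j \<or> j = i \<and> t \<in> set (take k (ps i))"
    let ?loop = "For ''k'' (NGet ''size'' (V ''i''))
      (NSet ''member'' (NAdd (NGet ''rm'' (V ''i'')) listed) (NNum 1))"
    have "runs ?loop s (m * (1 + 2) + 2) (?J (card (p i)))"
    proof (rule runs_For[where I = ?J and N = "card (p i)"], goal_cases)
      case (3 s1)
      with indexed_frame[OF s 3] frame_nmem[OF 3, of "''i''"] i show ?case by (auto simp: indexedD)
    next
      case (4 k s1)
      have s1: "indexed s1" "nmem s1 ''i'' 0 = i"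
        using indexed_frame[OF s 4(2)] frame_nmem[OF 4(2), of "''i''"] i by auto
      have t: "ps i ! k < m"
        using 4(1) i ps[of i] length_ps[of i] p_less[of i] nth_mem[of k "ps i"] by auto
      have "take (Suc k) (ps i) = take k (ps i) @ [ps i ! k]"
        using 4(1) i by (simp add: take_Suc_conv_app_nth length_ps)
      with 4 i s1 t show ?case
        by (intro runs_loopfree) (auto simp: indexedD row_eq_iff)
    qed (use 4(4) i card_p_le in auto)
    then show ?case
      by (rule runs_frame) (use i ps length_ps in \<open>auto simp: less_Suc_eq\<close>)
  qed (use assms in auto)
  then show ?thesis by (rule runs_frame) (auto simp: algebra_simps)
qed

lemma runs_seed_queue:
  assumes "indexed s0" "nmem s0 ''adopted'' = (\<lambda>_. 0)" "nmem s0 ''tail'' 0 = 0"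
  shows "runs seed_queue s0 (n * 7 + 2)
    (\<lambda>s. propagated 0 0 (nmem s ''adopted'') (nmem s ''choice'') (nmem s ''queue'')
           (nmem s ''tail'' 0) (\<lambda>_. 0))"
proof -
  let ?I = "\<lambda>i s. queued (nmem s ''adopted'') (nmem s ''queue'') (nmem s ''tail'' 0) \<and>
    (\<forall>j. 0 < nmem s ''adopted'' j \<longleftrightarrow> j < i \<and> card (p j) < 2) \<and>
    (\<forall>j<i. card (p j) < 2 \<longrightarrow> p j = {nmem s ''choice'' j})"
  have "runs seed_queue s0 (n * (5 + 2) + 2) (?I n)"
    unfolding seed_queue_def
  proof (rule runs_For[where I = ?I and N = n], goal_cases)
    case (3 s)
    with indexed_frame[OF assms(1) 3] show ?case by (auto simp: indexedD program_defs)
  next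
    case (4 i s)
    have s: "indexed s"
      using indexed_frame[OF assms(1) 4(2)] by (auto simp: program_defs)
    have single: "p i = {ps i ! 0}" if "card (p i) < 2"
    proof -
      have "card (p i) = 1" using that card_p_pos[OF 4(1)] by linarith
      then have "length (ps i) = 1" using length_ps[OF 4(1)] by simp
      then obtain x where "ps i = [x]" by (auto simp: length_Suc_conv)
      moreover have "p i = set (ps i)" using ps[OF 4(1)] by simp
      ultimately show ?thesis by simp
    qed
    have prod: "nmem s ''prod'' (i * m) = ps i ! 0"
      using indexedD(7)[OF s 4(1), of 0] card_p_pos[OF 4(1)] by simp
    \<comment> \<open>By the invariant \<open>i\<close> has not been marked as adopted, so it does
      not occur in the queue so far.\<close>
    have queued: "queued ((nmem s ''adopted'')(i := 1)) ((nmem s ''queue'')(nmem s ''tail'' 0 := i))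
        (Suc (nmem s ''tail'' 0))"
      using 4(1,4) by (auto simp: queued_def lessThan_Suc inj_on_def)
    show ?case
      by (rule runs_loopfree)
        (use 4 s single prod queued in \<open>auto simp: enqueue_def indexedD less_Suc_eq\<close>)
  qed (use assms in \<open>auto simp: queued_def enqueue_def\<close>)
  then show ?thesis
    by (rule runs_frame) (auto intro!: propagated_init)
qed

lemma runs_find_conflicts:
  assumes "indexed s0"
  shows "runs find_conflicts s0 (n * (m * 4 + 4) + 2)
    (\<lambda>s. 0 < nmem s ''bad'' 0 \<longleftrightarrow> 0 < nmem s0 ''bad'' 0 \<or>
      \<not> (\<forall>i<n. 2 \<le> card (p i) \<longrightarrow> (\<forall>t \<in> p i. threshold S i \<le> rmem s0 ''sum'' (i * m + t) \<longrightarrow>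
        t = nmem s0 ''choice'' i)))"
proof -
  define conflict where "conflict i t \<longleftrightarrow> 2 \<le> card (p i) \<and> threshold S i \<le> rmem s0 ''sum'' (i * m + t) \<and>
      t \<noteq> nmem s0 ''choice'' i" for i t
  let ?I = "\<lambda>i s. 0 < nmem s ''bad'' 0 \<longleftrightarrow>
    0 < nmem s0 ''bad'' 0 \<or> (\<exists>j<i. \<exists>t \<in> p j. conflict j t)"
  have "runs find_conflicts s0 (n * ((m * (2 + 2) + 2) + 2) + 2) (?I n)"
    unfolding find_conflicts_def
  proof (rule runs_For[where I = ?I and N = n], goal_cases)
    case (3 s)
    with indexed_frame[OF assms(1) 3] show ?case by (auto simp: indexedD)
  next
    case (4 i s)
    note i = \<open>i < n\<close> \<open>nmem s ''i'' 0 = i\<close>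
    have s: "indexed s" "nmem s ''choice'' = nmem s0 ''choice''" "rmem s ''sum'' = rmem s0 ''sum''"
      using indexed_frame[OF assms(1) 4(2)] frame_nmem[OF 4(2), of "''choice''"]
        frame_rmem[OF 4(2), of "''sum''"] by auto
    let ?J = "\<lambda>k s. 0 < nmem s ''bad'' 0 \<longleftrightarrow>
      0 < nmem s0 ''bad'' 0 \<or> (\<exists>j<i. \<exists>t \<in> p j. conflict j t) \<or> (\<exists>l<k. conflict i (ps i ! l))"
    have "runs (For ''k'' (NGet ''size'' (V ''i''))
      (When (BAnd (NLess (NNum 1) (NGet ''size'' (V ''i'')))
              (BAnd (BNot (RLess (RGet ''sum'' (NAdd (NGet ''rm'' (V ''i'')) listed))
                                 (RGet ''threshold'' (V ''i''))))
                (NLess (NNum 0) (NAdd (NSub listed (NGet ''choice'' (V ''i'')))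
                                      (NSub (NGet ''choice'' (V ''i'')) listed)))))
        (NSet ''bad'' (NNum 0) (NNum 1)))) s (m * (2 + 2) + 2) (?J (card (p i)))"
    proof (rule runs_For[where I = ?J and N = "card (p i)"], goal_cases)
      case (3 s1)
      with indexed_frame[OF s(1) 3] frame_nmem[OF 3, of "''i''"] i show ?case by (auto simp: indexedD)
    next
      case (4 k s1)
      have s1: "indexed s1" "nmem s1 ''i'' 0 = i" "nmem s1 ''choice'' = nmem s0 ''choice''"
          "rmem s1 ''sum'' = rmem s0 ''sum''"
        using indexed_frame[OF s(1) 4(2)] frame_nmem[OF 4(2), of "''i''"] i s
          frame_nmem[OF 4(2), of "''choice''"] frame_rmem[OF 4(2), of "''sum''"] by auto
      have "bval (BAnd (NLess (NNum 1) (NGet ''size'' (V ''i'')))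
              (BAnd (BNot (RLess (RGet ''sum'' (NAdd (NGet ''rm'' (V ''i'')) listed))
                                 (RGet ''threshold'' (V ''i''))))
                (NLess (NNum 0) (NAdd (NSub listed (NGet ''choice'' (V ''i'')))
                                      (NSub (NGet ''choice'' (V ''i'')) listed))))) s1
          \<longleftrightarrow> conflict i (ps i ! k)"
        using s1 i 4(1,3) by (auto simp: indexedD conflict_def)
      with 4(4) show ?case
        by (intro runs_loopfree) (auto simp: less_Suc_eq simp del: bval.simps)
    qed (use 4(4) i card_p_le in auto)
    then show ?case
    proof (rule runs_frame)
      have "(\<exists>l<card (p i). conflict i (ps i ! l)) \<longleftrightarrow> (\<exists>t \<in> p i. conflict i t)"
        using ps[OF i(1)] length_ps[OF i(1)] by (metis in_set_conv_nth)
      then show "?I (Suc i) (nset ''i'' 0 (Suc i) s')" if "?J (card (p i)) s'" for s'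
        using that by (auto simp: less_Suc_eq)
    qed simp
  qed auto
  then show ?thesis by (rule runs_frame) (auto simp: algebra_simps conflict_def)
qed

section \<open>The propagation loop\<close>

abbreviation progress :: "nat \<Rightarrow> nat \<Rightarrow> mem \<Rightarrow> bool" where
  "progress h k s \<equiv> propagated h k (nmem s ''adopted'') (nmem s ''choice'') (nmem s ''queue'')
     (nmem s ''tail'' 0) (rmem s ''sum'')"

text \<open>Also keeps track that the values loaded into \<open>cur\<close> and \<open>t\<close>
  stay current, although \<open>enqueue\<close> writes to the arrays they were read from.\<close>

definition announcing :: "nat \<Rightarrow> nat \<Rightarrow> nat \<Rightarrow> nat \<Rightarrow> mem \<Rightarrow> bool" where
  "announcing h i t k s \<longleftrightarrow> progress h k s \<and> h < nmem s ''tail'' 0 \<and>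
     nmem s ''queue'' h = i \<and> nmem s ''choice'' i = t"

text \<open>The three cases are those of \<open>propagated_skip\<close>,
  \<open>propagated_inform\<close> and \<open>propagated_adopt\<close>. On adoption, queue entry
  \<open>h\<close> survives as \<open>h\<close> is below \<open>tail\<close>, and the choice of
  \<open>i\<close> survives as \<open>i\<close> has adopted and \<open>k\<close> has not.\<close>

lemma sem_inform:
  assumes s: "indexed s" and member: "\<And>t. t < m \<Longrightarrow> 0 < nmem s ''member'' (k * m + t) \<longleftrightarrow> t \<in> p k"
    and A: "announcing h i t k s"
    and k: "k < n" "nmem s ''j'' 0 = k" and it: "nmem s ''cur'' 0 = i" "nmem s ''t'' 0 = t"
  shows "announcing h i t (Suc k) (sem inform s)"
proof -
  let ?ad = "nmem s ''adopted''" and ?prd = "nmem s ''choice''" and ?q = "nmem s ''queue''"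
    and ?e = "nmem s ''tail'' 0" and ?W = "rmem s ''sum''"
  define W' where "W' = bump i k t ?W"
  from A have P: "propagated h k ?ad ?prd ?q ?e ?W" and h: "h < ?e" and q: "?q h = i" and t: "?prd i = t"
    by (auto simp: announcing_def)
  from P have queued: "queued ?ad ?q ?e" by (simp add: propagated_def)
  from queue_entry[OF queued h] q have i: "i < n" "0 < ?ad i" by auto
  with P t have "t \<in> p i" unfolding propagated_def by blast
  with i have "t < m" by (simp add: p_less)
  note simps = inform_def enqueue_def Let_def indexedD[OF s] i k it t \<open>t < m\<close> member
  consider (skip) "(i, k) \<notin> edges S"
    | (inform) "(i, k) \<in> edges S" "\<not> (?ad k = 0 \<and> t \<in> p k \<and> threshold S k \<le> W' (k * m + t))"
    | (adopt) "(i, k) \<in> edges S" "?ad k = 0" "t \<in> p k" "threshold S k \<le> W' (k * m + t)"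
    by blast
  then show ?thesis
  proof cases
    case skip
    then have "sem inform s = s" by (simp add: simps)
    with propagated_skip[OF P h] A skip q show ?thesis by (simp add: announcing_def)
  next
    case inform
    then have "sem inform s = rset ''sum'' (k * m + t) (W' (k * m + t)) s"
      by (auto simp: simps W'_def bump_def)
    with propagated_inform[OF P h k(1), of W'] A inform q t show ?thesis
      by (auto simp: announcing_def W'_def bump_def)
  next
    case adopt
    then have "sem inform s = nset ''tail'' 0 (Suc ?e) (nset ''queue'' ?e k (nset ''choice'' k t
        (nset ''adopted'' k 1 (rset ''sum'' (k * m + t) (W' (k * m + t)) s))))"
      by (auto simp: simps W'_def bump_def)
    with propagated_adopt[OF P h k(1), of W'] A adopt q t h i show ?thesis
      by (auto simp: announcing_def W'_def bump_def)
  qed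
qed

lemma runs_propagate:
  assumes s0: "indexed s0"
    and member: "\<And>j t. j < n \<Longrightarrow> t < m \<Longrightarrow> 0 < nmem s0 ''member'' (j * m + t) \<longleftrightarrow> t \<in> p j"
    and "nmem s0 ''head'' 0 = 0" "progress 0 0 s0"
  shows "runs propagate s0 (n * (n * 9 + 6) + 1) (\<lambda>s. progress (nmem s ''tail'' 0) 0 s)"
proof -
  \<comment> \<open>During the loop \<open>tail\<close> may grow, so the measure is
    \<open>n - head\<close> and not \<open>tail - head\<close>. It decreases because
    \<open>head < tail \<le> n\<close> in each iteration.\<close>
  let ?I = "\<lambda>s. progress (nmem s ''head'' 0) 0 s" and ?\<mu> = "\<lambda>s. n - nmem s ''head'' 0"
  have "runs propagate s0 (?\<mu> s0 * ((n * 9 + 5) + 1) + 1)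
      (\<lambda>s. ?I s \<and> \<not> bval (NLess (V ''head'') (V ''tail'')) s)"
    unfolding propagate_def
  proof (rule runs_While[where I = ?I], goal_cases)
    case (2 s)
    define h i t where "h = nmem s ''head'' 0" and "i = nmem s ''queue'' h" and "t = nmem s ''choice'' i"
    from 2(2,3) have P: "progress h 0 s" and h: "h < nmem s ''tail'' 0" by (simp_all add: h_def)
    have s: "indexed s"
      using indexed_frame[OF s0 2(1)] by (auto simp: program_defs Let_def)
    have s_member: "nmem s ''member'' = nmem s0 ''member''"
      using frame_nmem[OF 2(1), of "''member''"] by (auto simp: program_defs Let_def)
    let ?c1 = "NSet ''cur'' (NNum 0) (NGet ''queue'' (V ''head''))"
    let ?c2 = "NSet ''t'' (NNum 0) (NGet ''choice'' (V ''cur''))"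
    let ?c4 = "NSet ''head'' (NNum 0) (NAdd (V ''head'') (NNum 1))"
    define s2 where "s2 = sem (?c1 ;; ?c2) s"
    have s2: "nmem s2 ''cur'' 0 = i" "nmem s2 ''t'' 0 = t" "nmem s2 ''head'' 0 = h"
        "nmem s2 ''member'' = nmem s0 ''member''" "announcing h i t 0 (nset ''j'' 0 0 s2)"
      using P h s_member by (simp_all add: s2_def announcing_def h_def i_def t_def)
    have fr2: "frame (?c1 ;; ?c2) s s2"
      by (auto simp: s2_def frame_def)
    have indexed2: "indexed s2" by (rule indexed_frame[OF s fr2]) auto
    have loop: "runs (For ''j'' (V ''n'') inform) s2 (n * (7 + 2) + 2) (announcing h i t n)"
    proof (rule runs_For[where I = "announcing h i t" and N = n], goal_cases)
      case (3 s3)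
      with indexed_frame[OF indexed2 3] show ?case by (auto simp: indexedD program_defs Let_def)
    next
      case (4 k s3)
      have "indexed s3"
        using indexed_frame[OF indexed2 4(2)] by (auto simp: program_defs Let_def)
      moreover have "nmem s3 ''member'' = nmem s0 ''member''" "nmem s3 ''cur'' 0 = i" "nmem s3 ''t'' 0 = t"
        using frame_nmem[OF 4(2)] s2 by (simp_all add: program_defs Let_def)
      ultimately have "announcing h i t (Suc k) (sem inform s3)"
        using 4 member by (intro sem_inform) auto
      then show ?case
        by (intro runs_loopfree) (simp_all add: announcing_def, simp_all add: program_defs Let_def)
    qed (use s2 in \<open>auto simp: program_defs Let_def\<close>)
    show ?case
    proof (rule runs_Seq[where R = "\<lambda>s1. s1 = sem ?c1 s" and Ta = 1 and Tb = "n * 9 + 4"])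
      fix s1 assume s1: "s1 = sem ?c1 s"
      show "runs (?c2 ;; For ''j'' (V ''n'') inform ;; ?c4) s1 (n * 9 + 4)
          (\<lambda>s'. ?I s' \<and> ?\<mu> s' < ?\<mu> s)"
      proof (rule runs_Seq[where R = "\<lambda>s'. s' = s2" and Ta = 1 and Tb = "n * 9 + 3"])
        fix s' assume "s' = s2"
        show "runs (For ''j'' (V ''n'') inform ;; ?c4) s' (n * 9 + 3) (\<lambda>s'. ?I s' \<and> ?\<mu> s' < ?\<mu> s)"
          unfolding \<open>s' = s2\<close>
        proof (rule runs_Seq[OF loop, where Tb = 1])
          fix s3 assume fr3: "frame (For ''j'' (V ''n'') inform) s2 s3" and A: "announcing h i t n s3"
          have "nmem s3 ''head'' 0 = h"
            using frame_nmem[OF fr3, of "''head''"] s2 by (simp add: program_defs Let_def)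
          moreover have "progress (Suc h) 0 s3"
            using A by (auto simp: announcing_def intro: propagated_next_row)
          moreover have "h < n"
            using P h queue_length_le by (fastforce simp: propagated_def)
          ultimately show "runs ?c4 s3 1 (\<lambda>s'. ?I s' \<and> ?\<mu> s' < ?\<mu> s)"
            by (intro runs_loopfree) (auto simp: h_def)
        qed simp
      qed (auto intro!: runs_loopfree simp: s1 s2_def)
    qed (auto intro!: runs_loopfree)
  qed (use assms in simp)
  then show ?thesis
  proof (rule runs_frame)
    fix s :: mem assume "?I s \<and> \<not> bval (NLess (V ''head'') (V ''tail'')) s"
    \<comment> \<open>The invariant contains \<open>head \<le> tail\<close>, and the failed test
      gives the converse.\<close>
    moreover from this have "nmem s ''head'' 0 = nmem s ''tail'' 0" by (simp add: propagated_def)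
    ultimately show "progress (nmem s ''tail'' 0) 0 s" by simp
  qed (use assms(3) in simp)
qed

section \<open>The two complete programs\<close>

lemma runs_index_rows_encode:
  "runs index_rows (encode n m S ps) (n * 4 + 2) indexed"
  by (rule runs_index_rows[OF loaded_encode]) (simp_all add: encode_def)

lemma encode_zero:
  "a \<notin> inputs \<Longrightarrow> nmem (encode n m S ps) a = (\<lambda>_. 0)"
  "a \<notin> {''weight'', ''threshold''} \<Longrightarrow> rmem (encode n m S ps) a = (\<lambda>_. 0)"
  by (simp_all add: encode_def)

lemma runs_answer:
  "nmem (s :: mem) ''bad'' 0 = 0 \<longleftrightarrow> b \<Longrightarrow> runs answer s 1 (\<lambda>s. nmem s ''result'' 0 = (if b then 1 else 0))"
  by (rule runs_loopfree) (auto simp: answer_def)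

lemma runs_decide_large_thresholds:
  assumes "\<And>i. i < n \<Longrightarrow> threshold S i > 1 / 2"
  shows "runs decide_large_thresholds (encode n m S ps) (20 * (n * n + 1))
    (\<lambda>s. nmem s ''result'' 0 = (if unique_outcome S p then 1 else 0))"
  unfolding decide_large_thresholds_def
proof (rule runs_Seq[OF runs_index_rows_encode])
  fix s1 assume fr1: "frame index_rows (encode n m S ps) s1" and s1: "indexed s1"
  have bad: "nmem s1 ''bad'' 0 = 0"
    using frame_nmem[OF fr1, of "''bad''"] by (simp add: program_defs encode_zero)
  show "runs (find_sources ;; answer) s1 (n * (n * 4 + 7) + 3)
      (\<lambda>s. nmem s ''result'' 0 = (if unique_outcome S p then 1 else 0))"
  proof (rule runs_Seq[OF runs_find_sources[OF s1 bad]])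
    fix s :: mem assume "0 < nmem s ''bad'' 0 \<longleftrightarrow> (\<exists>i<n. 2 \<le> card (p i) \<and> neighbours S i = {})"
    then show "runs answer s 1 (\<lambda>s. nmem s ''result'' 0 = (if unique_outcome S p then 1 else 0))"
      using not_unique_outcome_source[OF valid p] unique_outcome_large_thresholds[OF valid p] assms nodes
      by (intro runs_answer) (metis lessThan_iff neq0_conv)
  qed simp
next
  have "n \<le> n * n" by (cases n) auto
  moreover have "c = 4 * a + 7 * n \<Longrightarrow> n \<le> a \<Longrightarrow> n * 4 + 2 + (c + 3) \<le> 20 * (a + 1)"
    for a c by simp
  moreover have "n * (n * 4 + 7) = 4 * (n * n) + 7 * n" by (simp add: algebra_simps)
  ultimately show "n * 4 + 2 + (n * (n * 4 + 7) + 3) \<le> 20 * (n * n + 1)" by blast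
qed

lemma runs_decide:
  "runs decide (encode n m S ps) (50 * (n * n + n * m + 1))
    (\<lambda>s. nmem s ''result'' 0 = (if unique_outcome S p then 1 else 0))"
  (is "runs _ _ _ ?Q")
  unfolding decide_def
proof (rule runs_Seq[OF runs_index_rows_encode])
  let ?s0 = "encode n m S ps"
  fix s1 assume fr1: "frame index_rows ?s0 s1" and s1: "indexed s1"
  have zero1: "nmem s1 ''bad'' 0 = 0" "nmem s1 ''member'' = (\<lambda>_. 0)" "nmem s1 ''adopted'' = (\<lambda>_. 0)"
      "nmem s1 ''tail'' = (\<lambda>_. 0)" "nmem s1 ''head'' = (\<lambda>_. 0)" "rmem s1 ''sum'' = (\<lambda>_. 0)"
    using frame_nmem[OF fr1] frame_rmem[OF fr1] by (simp_all add: program_defs encode_zero)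
  show "runs (find_sources ;; mark_products ;; seed_queue ;; propagate ;; find_conflicts ;; answer) s1
      (n * (n * 13 + m * 7 + 28) + 11) ?Q"
  proof (rule runs_Seq[OF runs_find_sources[OF s1 zero1(1)], where Tb = "n * (n * 9 + m * 7 + 21) + 9"])
    fix s2 assume fr2: "frame find_sources s1 s2"
      and bad: "0 < nmem s2 ''bad'' 0 \<longleftrightarrow> (\<exists>i<n. 2 \<le> card (p i) \<and> neighbours S i = {})"
    have s2: "indexed s2" by (rule indexed_frame[OF s1 fr2]) (auto simp: program_defs)
    have zero2: "nmem s2 ''member'' = (\<lambda>_. 0)" "nmem s2 ''adopted'' = (\<lambda>_. 0)"
        "nmem s2 ''tail'' = (\<lambda>_. 0)" "nmem s2 ''head'' = (\<lambda>_. 0)" "rmem s2 ''sum'' = (\<lambda>_. 0)"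
      using frame_nmem[OF fr2] frame_rmem[OF fr2] zero1 by (simp_all add: program_defs)
    show "runs (mark_products ;; seed_queue ;; propagate ;; find_conflicts ;; answer) s2
        (n * (n * 9 + m * 7 + 21) + 9) ?Q"
    proof (rule runs_Seq[OF runs_mark_products[OF s2 zero2(1)], where Tb = "n * (n * 9 + m * 4 + 17) + 7"])
      fix s3 assume fr3: "frame mark_products s2 s3"
        and member: "\<forall>j<n. \<forall>t<m. 0 < nmem s3 ''member'' (j * m + t) \<longleftrightarrow> t \<in> p j"
      have s3: "indexed s3" by (rule indexed_frame[OF s2 fr3]) (auto simp: program_defs)
      have zero3: "nmem s3 ''adopted'' = (\<lambda>_. 0)" "nmem s3 ''tail'' 0 = 0" "nmem s3 ''head'' 0 = 0"
          "rmem s3 ''sum'' = (\<lambda>_. 0)" and bad3: "nmem s3 ''bad'' 0 = nmem s2 ''bad'' 0"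
        using frame_nmem[OF fr3] frame_rmem[OF fr3] zero2 by (simp_all add: program_defs)
      show "runs (seed_queue ;; propagate ;; find_conflicts ;; answer) s3
          (n * (n * 9 + m * 4 + 17) + 7) ?Q"
      proof (rule runs_Seq[OF runs_seed_queue[OF s3 zero3(1,2)],
            where Tb = "n * (n * 9 + m * 4 + 10) + 4"])
        fix s4 assume fr4: "frame seed_queue s3 s4"
          and P: "propagated 0 0 (nmem s4 ''adopted'') (nmem s4 ''choice'') (nmem s4 ''queue'')
            (nmem s4 ''tail'' 0) (\<lambda>_. 0)"
        have s4: "indexed s4" by (rule indexed_frame[OF s3 fr4]) (auto simp: program_defs)
        have *: "nmem s4 ''head'' 0 = 0" "rmem s4 ''sum'' = (\<lambda>_. 0)"
            "nmem s4 ''bad'' 0 = nmem s2 ''bad'' 0" "nmem s4 ''member'' = nmem s3 ''member''"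
          using frame_nmem[OF fr4] frame_rmem[OF fr4] zero3 bad3 by (simp_all add: program_defs)
        have "runs propagate s4 (n * (n * 9 + 6) + 1) (\<lambda>s. progress (nmem s ''tail'' 0) 0 s)"
          using s4 member * P by (intro runs_propagate) auto
        then show "runs (propagate ;; find_conflicts ;; answer) s4 (n * (n * 9 + m * 4 + 10) + 4) ?Q"
        proof (rule runs_Seq[where Tb = "n * (m * 4 + 4) + 3"])
          fix s5 assume fr5: "frame propagate s4 s5" and P5: "progress (nmem s5 ''tail'' 0) 0 s5"
          have s5: "indexed s5" by (rule indexed_frame[OF s4 fr5]) (auto simp: program_defs Let_def)
          have bad5: "nmem s5 ''bad'' 0 = nmem s2 ''bad'' 0"
            using frame_nmem[OF fr5] * by (simp add: program_defs Let_def)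
          show "runs (find_conflicts ;; answer) s5 (n * (m * 4 + 4) + 3) ?Q"
          proof (rule runs_Seq[OF runs_find_conflicts[OF s5], where Tb = 1], rule runs_answer)
            fix s :: mem assume "0 < nmem s ''bad'' 0 \<longleftrightarrow> 0 < nmem s5 ''bad'' 0 \<or>
              \<not> (\<forall>i<n. 2 \<le> card (p i) \<longrightarrow> (\<forall>t \<in> p i. threshold S i \<le> rmem s5 ''sum'' (i * m + t) \<longrightarrow>
                t = nmem s5 ''choice'' i))"
            \<comment> \<open>If there is an undecided node without neighbours, \<open>bad\<close>
              was already set and \<open>not_unique_outcome_source\<close> applies. Otherwise the
              second hypothesis of \<open>unique_outcome_iff_propagated\<close> holds.\<close>
            then show "nmem s ''bad'' 0 = 0 \<longleftrightarrow> unique_outcome S p"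
              using bad bad5 not_unique_outcome_source[OF valid p] nodes
                unique_outcome_iff_propagated[OF P5]
              by (metis lessThan_iff neq0_conv)
          qed simp
        qed (simp add: algebra_simps)
      qed (simp add: algebra_simps)
    qed (simp add: algebra_simps)
  qed (simp add: algebra_simps)
next
  \<comment> \<open>This absorbs the linear terms. With the products abstracted to \<open>a\<close>,
    \<open>b\<close> and \<open>c\<close>, linear arithmetic remains.\<close>
  have "n \<le> n * n" by (cases n) auto
  moreover have "c = 13 * a + 7 * b + 28 * n \<Longrightarrow> n \<le> a \<Longrightarrow> n * 4 + 2 + (c + 11) \<le> 50 * (a + b + 1)"
    for a b c by simp
  moreover have "n * (n * 13 + m * 7 + 28) = 13 * (n * n) + 7 * (n * m) + 28 * n"
    by (simp add: algebra_simps)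
  ultimately show "n * 4 + 2 + (n * (n * 13 + m * 7 + 28) + 11) \<le> 50 * (n * n + n * m + 1)"
    by blast
qed

end

section \<open>Asymptotic time bounds\<close>

theorem theorem7:
  "(\<exists>c T. (\<lambda>(n, m). real (T n m))
            \<in> O[principal {(n, m). n \<ge> 1}](\<lambda>(n, m). real n ^ 2 + real n * real m) \<and>
          decides_unique_outcome c (\<lambda>S. True) T) \<and>
   (\<exists>c T. (\<lambda>n. real (T n)) \<in> O(\<lambda>n. real n ^ 2) \<and>
          decides_unique_outcome c (\<lambda>S. \<forall>i \<in> nodes S. threshold S i > 1 / 2) (\<lambda>n m. T n))"
proof
  let ?T = "\<lambda>n m. 50 * (n * n + n * m + 1)"
  have "(\<lambda>(n, m). real (?T n m))
      \<in> O[principal {(n, m). n \<ge> 1}](\<lambda>(n, m). real n ^ 2 + real n * real m)"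
  \<comment> \<open>Doubling the factor 50 absorbs the additive constant, since \<open>n * n\<close>
    is at least 1 for \<open>n \<ge> 1\<close>. The filter leaves \<open>m\<close>
    arbitrary.\<close>
  proof (rule bigoI[where c = 100], unfold eventually_principal, safe)
    fix n m :: nat assume "n \<ge> 1"
    then have "?T n m \<le> 100 * (n * n + n * m)" by (cases n) auto
    then have "real (?T n m) \<le> real (100 * (n * n + n * m))" by (rule of_nat_mono)
    then show "norm (real (?T n m)) \<le> 100 * norm (real n ^ 2 + real n * real m)"
      by (simp add: power2_eq_square)
  qed
  moreover have "decides_unique_outcome decide (\<lambda>S. True) ?T"
    unfolding decides_unique_outcome_def
  proof (intro allI impI, elim conjE)
    fix n m :: nat and S :: "(nat, nat) setting" and p ps
    assume "valid_setting S" "nodes S = {..<n}" "products S = {..<m}" "p \<in> social_networks S"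
      and "\<forall>i<n. distinct (ps i) \<and> set (ps i) = p i"
    then interpret network_input n m S p ps by unfold_locales auto
    show "\<exists>t s. t \<le> ?T n m \<and> exec decide (encode n m S ps) t s \<and>
        nmem s ''result'' 0 = (if unique_outcome S p then 1 else 0)"
      using runs_decide unfolding runs_def by blast
  qed
  ultimately show "\<exists>c T. (\<lambda>(n, m). real (T n m))
            \<in> O[principal {(n, m). n \<ge> 1}](\<lambda>(n, m). real n ^ 2 + real n * real m) \<and>
          decides_unique_outcome c (\<lambda>S. True) T"
    by (intro exI conjI)
next
  let ?T = "\<lambda>n. 20 * (n * n + 1)"
  have "(\<lambda>n. real (?T n)) \<in> O(\<lambda>n. real n ^ 2)"
  proof (rule bigoI[where c = 40], rule eventually_mono[OF eventually_ge_at_top[of 1]])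
    fix n :: nat assume "1 \<le> n"
    then have "?T n \<le> 40 * (n * n)" by (cases n) auto
    then have "real (?T n) \<le> real (40 * (n * n))" by (rule of_nat_mono)
    then show "norm (real (?T n)) \<le> 40 * norm (real n ^ 2)"
      by (simp add: power2_eq_square)
  qed
  moreover have "decides_unique_outcome decide_large_thresholds
      (\<lambda>S. \<forall>i \<in> nodes S. threshold S i > 1 / 2) (\<lambda>n m. ?T n)"
    unfolding decides_unique_outcome_def
  proof (intro allI impI, elim conjE)
    fix n m :: nat and S :: "(nat, nat) setting" and p ps
    assume large: "\<forall>i \<in> nodes S. threshold S i > 1 / 2"
    assume "valid_setting S" "nodes S = {..<n}" "products S = {..<m}" "p \<in> social_networks S"
      and "\<forall>i<n. distinct (ps i) \<and> set (ps i) = p i"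
    then interpret network_input n m S p ps by unfold_locales auto
    have runs: "runs decide_large_thresholds (encode n m S ps) (?T n)
        (\<lambda>s. nmem s ''result'' 0 = (if unique_outcome S p then 1 else 0))"
      by (rule runs_decide_large_thresholds) (use large nodes in simp)
    show "\<exists>t s. t \<le> ?T n \<and> exec decide_large_thresholds (encode n m S ps) t s \<and>
        nmem s ''result'' 0 = (if unique_outcome S p then 1 else 0)"
      using runs unfolding runs_def by blast
  qed
  ultimately show "\<exists>c T. (\<lambda>n. real (T n)) \<in> O(\<lambda>n. real n ^ 2) \<and>
          decides_unique_outcome c (\<lambda>S. \<forall>i \<in> nodes S. threshold S i > 1 / 2) (\<lambda>n m. T n)"
    by (intro exI conjI)
qed

end
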